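(* Let $f$ be the exact solution of the doubly periodic problem described in the context, and assume that $f$ is smooth and spatially periodic on $\Omega$. Let $\Delta t=h_1=h_2$, let $f_{h,i,j}^n$ be the numerical solution of the periodic scheme described in the context, let $e_{i,j}^n=f_{h,i,j}^n-f(x_i,y_j,t_n)$ and $\|e^n\|_\infty=\max_{0\le i\le M_1,\,0\le j\le M_2}|e_{i,j}^n|$. Then $$\|e^n\|_\infty\le O(\Delta t),$$ that is, there exists a constant $C>0$, independent of the mesh sizes, such that $\|e^n\|_\infty\le C\,\Delta t$.
   Context: **Problem.** $\Omega=(x_0,x_{M_1})\times(y_0,y_{M_2})$ is a fixed open rectangle, $L_x=x_{M_1}-x_0$, $L_y=y_{M_2}-y_0$, and $T>0$. The functions $\rho,\sigma_1,\sigma_2,r,b_1,b_2$ are continuous on $\mathbb R^2\times[0,T)$, with $\rho\in[-1,1]$, $\sigma_1>0$, $\sigma_2>0$, $r\ge0$; they, as well as the terminal data $\varphi$ and the solution $f$, are periodic in $x$ with period $L_x$ and in $y$ with period $L_y$. The function $f$ solves $$\partial_t f+\tfrac12\sigma_1^2\,\partial_{xx}f+\rho\sigma_1\sigma_2\,\partial_{xy}f+\tfrac12\sigma_2^2\,\partial_{yy}f+b_1\partial_xf+b_2\partial_yf-rf=0\quad\text{on }\mathbb R^2\times[0,T),$$ with $f(x,y,T)=\varphi(x,y)$ on $\mathbb R^2$. **Grid.** $h_1=L_x/M_1$, $h_2=L_y/M_2$, $\Delta t=T/N$; $x_i=x_0+ih_1$ ($0\le i\le M_1$), $y_j=y_0+jh_2$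 ($0\le j\le M_2$), $t_n=n\Delta t$ ($0\le n\le N$). **Branch points.** Put $\theta=\tfrac12\arcsin\rho\in[-\pi/4,\pi/4]$. At a node $(x_i,y_j)$ and $0\le n\le N-1$, write $\sigma_k,b_k,r$ for the values at $(x_i,y_j,t_n)$ and $\alpha=\sin\theta+\cos\theta$, $\beta=\sin\theta-\cos\theta$ with $\theta$ evaluated at $(x_i,y_j,t_n)$. Define $$\begin{aligned}(x_1^*,y_1^* )&=(x_i+b_1\Delta t+\alpha\sigma_1\sqrt{\Delta t},\;y_j+b_2\Delta t+\alpha\sigma_2\sqrt{\Delta t}),\\(x_2^*,y_2^* )&=(x_i+b_1\Delta t-\beta\sigma_1\sqrt{\Delta t},\;y_j+b_2\Delta t+\beta\sigma_2\sqrt{\Delta t}),\\(x_3^*,y_3^* )&=(x_i+b_1\Delta t-\alpha\sigma_1\sqrt{\Delta t},\;y_j+b_2\Delta t-\alpha\sigma_2\sqrt{\Delta t}),\\(x_4^*,y_4^* )&=(x_i+b_1\Delta t+\beta\sigma_1\sqrt{\Delta t},\;y_j+b_2\Delta t-\beta\sigma_2\sqrt{\Delta t}).\end{aligned}$$ The wrapping operator is $\mathcal W(x,y)=\bigl(x_0+((x-x_0)\bmod L_x),\,y_0+((y-y_0)\bmod L_y)\bigr)$, with residues taken in $[0,L_x)$ and $[0,L_y)$, and $(X_k^h,Y_k^h)=\mathcal W(x_k^*,y_k^* )$ for $k=1,\dots,4$. **Interpolation.** $\mathcal L^{\mathrm{sp}}g(x,y,t_m)$ is the bilinear interpolant in space,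 at time level $t_m$, of the grid values of $g$ at the four vertices of the grid cell containing $(x,y)$. **Scheme.** $f_{h,i,j}^N=\varphi(x_i,y_j)$ at all nodes, and for $n=N-1,\dots,0$ and all $0\le i\le M_1$, $0\le j\le M_2$, $$f_{h,i,j}^n=\frac{1}{4(1+r\Delta t)}\sum_{k=1}^4\mathcal L^{\mathrm{sp}}f_h(X_k^h,Y_k^h,t_{n+1}).$$
   Formalization: The coefficients σ₁, σ₂, b₁, b₂ are additionally assumed bounded on ℝ²×[0,T); with mere continuity on [0,T) the claim fails, e.g. when σ₁ blows up like 1/√(T−t). Smoothness of f is understood on ℝ²×[0,T], up to t=T. *)

theory Defs
  imports "HOL-Analysis.Analysis" "HOL-Library.Real_Mod"
begin

text \<open>The data of the problem on the rectangle \<open>(xlo, xhi) \<times> (ylo, yhi)\<close> with time horizon \<open>hor\<close>.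
  Coefficients take the arguments \<open>x\<close>, \<open>y\<close>, \<open>t\<close> in this order; only their values for
  \<open>0 \<le> t < hor\<close> are ever constrained or used.\<close>

record periodic_problem =
  xlo :: real
  xhi :: real
  ylo :: real
  yhi :: real
  hor :: real
  rho :: "real \<Rightarrow> real \<Rightarrow> real \<Rightarrow> real"
  sigma1 :: "real \<Rightarrow> real \<Rightarrow> real \<Rightarrow> real"
  sigma2 :: "real \<Rightarrow> real \<Rightarrow> real \<Rightarrow> real"
  rate :: "real \<Rightarrow> real \<Rightarrow> real \<Rightarrow> real"
  drift1 :: "real \<Rightarrow> real \<Rightarrow> real \<Rightarrow> real"
  drift2 :: "real \<Rightarrow> real \<Rightarrow> real \<Rightarrow> real"
  terminal :: "real \<Rightarrow> real \<Rightarrow> real"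

definition Lx :: "periodic_problem \<Rightarrow> real" where
  "Lx P = xhi P - xlo P"

definition Ly :: "periodic_problem \<Rightarrow> real" where
  "Ly P = yhi P - ylo P"

definition doubly_periodic :: "periodic_problem \<Rightarrow> (real \<Rightarrow> real \<Rightarrow> real) \<Rightarrow> bool" where
  "doubly_periodic P g \<longleftrightarrow> (\<forall>x y. g (x + Lx P) y = g x y \<and> g x (y + Ly P) = g x y)"

definition admissible_coeff :: "periodic_problem \<Rightarrow> (real \<Rightarrow> real \<Rightarrow> real \<Rightarrow> real) \<Rightarrow> bool" where
  "admissible_coeff P c \<longleftrightarrow>
     continuous_on (UNIV \<times> UNIV \<times> {0..<hor P}) (\<lambda>(x, y, t). c x y t) \<and>
     (\<forall>t\<in>{0..<hor P}. doubly_periodic P (\<lambda>x y. c x y t))"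

definition admissible_problem :: "periodic_problem \<Rightarrow> bool" where
  "admissible_problem P \<longleftrightarrow>
     xlo P < xhi P \<and> ylo P < yhi P \<and> 0 < hor P \<and>
     (\<forall>c\<in>{rho P, sigma1 P, sigma2 P, rate P, drift1 P, drift2 P}. admissible_coeff P c) \<and>
     (\<forall>x y. \<forall>t\<in>{0..<hor P}.
        rho P x y t \<in> {-1..1} \<and> 0 < sigma1 P x y t \<and> 0 < sigma2 P x y t \<and> 0 \<le> rate P x y t) \<and>
     doubly_periodic P (terminal P)"

text \<open>Continuity and periodicity bound the coefficients on \<open>[0, t]\<close> for each \<open>t < hor\<close>, but not
  uniformly as \<open>t\<close> tends to \<open>hor\<close>. First-order convergence fails if \<open>\<sigma>\<^sub>1\<close> blows up like
  \<open>1 / sqrt (hor - t)\<close>, so this bound is a separate hypothesis; none is needed for \<open>rate\<close>.\<close>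

definition bounded_sigma_drift :: "periodic_problem \<Rightarrow> bool" where
  "bounded_sigma_drift P \<longleftrightarrow>
     (\<forall>c\<in>{sigma1 P, sigma2 P, drift1 P, drift2 P}.
        bounded ((\<lambda>(x, y, t). c x y t) ` (UNIV \<times> UNIV \<times> {0..<hor P})))"

text \<open>The time derivative is taken within \<open>[0, hor]\<close>, hence is one-sided at \<open>t = 0\<close>.\<close>

definition solves :: "periodic_problem \<Rightarrow> (real \<Rightarrow> real \<Rightarrow> real \<Rightarrow> real) \<Rightarrow> bool" where
  "solves P f \<longleftrightarrow>
     (\<forall>x y. \<forall>t\<in>{0..<hor P}.
        vector_derivative (\<lambda>s. f x y s) (at t within {0..hor P})
        + 1/2 * (sigma1 P x y t)\<^sup>2 * deriv (\<lambda>u. deriv (\<lambda>v. f v y t) u) x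
        + rho P x y t * sigma1 P x y t * sigma2 P x y t * deriv (\<lambda>u. deriv (\<lambda>w. f u w t) y) x
        + 1/2 * (sigma2 P x y t)\<^sup>2 * deriv (\<lambda>w. deriv (\<lambda>z. f x z t) w) y
        + drift1 P x y t * deriv (\<lambda>u. f u y t) x
        + drift2 P x y t * deriv (\<lambda>w. f x w t) y
        - rate P x y t * f x y t = 0) \<and>
     (\<forall>x y. f x y (hor P) = terminal P x y) \<and>
     (\<forall>t\<in>{0..hor P}. doubly_periodic P (\<lambda>x y. f x y t))"

text \<open>\<open>C\<^sup>k\<close> on a set that need not be open, with derivatives taken within the set. \<open>D b\<close> is the
  partial derivative in the direction of the basis vector \<open>b\<close>; it is unique on convex sets with
  nonempty interior.\<close>

primrec Ck_on :: "nat \<Rightarrow> 'a::euclidean_space set \<Rightarrow> ('a \<Rightarrow> real) \<Rightarrow> bool" where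
  "Ck_on 0 S g \<longleftrightarrow> continuous_on S g"
| "Ck_on (Suc k) S g \<longleftrightarrow>
     (\<exists>D :: 'a \<Rightarrow> 'a \<Rightarrow> real.
        (\<forall>p\<in>S. (g has_derivative (\<lambda>v. \<Sum>b\<in>Basis. (v \<bullet> b) * D b p)) (at p within S)) \<and>
        (\<forall>b\<in>Basis. Ck_on k S (D b)))"

definition smooth_on :: "'a::euclidean_space set \<Rightarrow> ('a \<Rightarrow> real) \<Rightarrow> bool" where
  "smooth_on S g \<longleftrightarrow> (\<forall>k. Ck_on k S g)"

definition node_x :: "periodic_problem \<Rightarrow> nat \<Rightarrow> nat \<Rightarrow> real" where
  "node_x P M1 i = xlo P + real i * (Lx P / real M1)"

definition node_y :: "periodic_problem \<Rightarrow> nat \<Rightarrow> nat \<Rightarrow> real" where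
  "node_y P M2 j = ylo P + real j * (Ly P / real M2)"

definition node_t :: "periodic_problem \<Rightarrow> nat \<Rightarrow> nat \<Rightarrow> real" where
  "node_t P N n = real n * (hor P / real N)"

definition branch_points ::
  "periodic_problem \<Rightarrow> real \<Rightarrow> real \<Rightarrow> real \<Rightarrow> real \<Rightarrow> (real \<times> real) list" where
  "branch_points P dt x y t =
     (let \<theta> = arcsin (rho P x y t) / 2;
          \<alpha> = sin \<theta> + cos \<theta>;
          \<beta> = sin \<theta> - cos \<theta>;
          cx = x + drift1 P x y t * dt;
          cy = y + drift2 P x y t * dt;
          sx = sigma1 P x y t * sqrt dt;
          sy = sigma2 P x y t * sqrt dt
      in [(cx + \<alpha> * sx, cy + \<alpha> * sy),
          (cx - \<beta> * sx, cy + \<beta> * sy),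
          (cx - \<alpha> * sx, cy - \<alpha> * sy),
          (cx + \<beta> * sx, cy - \<beta> * sy)])"

definition wrap :: "periodic_problem \<Rightarrow> real \<times> real \<Rightarrow> real \<times> real" where
  "wrap P = (\<lambda>(x, y). (xlo P + (x - xlo P) rmod Lx P, ylo P + (y - ylo P) rmod Ly P))"

text \<open>Bilinear interpolation of grid values \<open>g i j\<close> at a point of
  \<open>[xlo, xhi) \<times> [ylo, yhi)\<close>, which is where \<open>wrap\<close> takes its values; there the cell indices
  satisfy \<open>i < M1\<close> and \<open>j < M2\<close>.\<close>

definition interp_sp ::
  "periodic_problem \<Rightarrow> nat \<Rightarrow> nat \<Rightarrow> (nat \<Rightarrow> nat \<Rightarrow> real) \<Rightarrow> real \<times> real \<Rightarrow> real" where
  "interp_sp P M1 M2 g = (\<lambda>(x, y).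
     let h1 = Lx P / real M1;
         h2 = Ly P / real M2;
         i = nat \<lfloor>(x - xlo P) / h1\<rfloor>;
         j = nat \<lfloor>(y - ylo P) / h2\<rfloor>;
         a = (x - node_x P M1 i) / h1;
         b = (y - node_y P M2 j) / h2
     in (1 - a) * (1 - b) * g i j + a * (1 - b) * g (Suc i) j
        + (1 - a) * b * g i (Suc j) + a * b * g (Suc i) (Suc j))"

text \<open>\<open>F n i j\<close> is the numerical value at time level \<open>n\<close> and node \<open>(i, j)\<close>. The equations determine
  it on the whole grid by backward recursion in \<open>n\<close>.\<close>

definition scheme_solution ::
  "periodic_problem \<Rightarrow> nat \<Rightarrow> nat \<Rightarrow> nat \<Rightarrow> (nat \<Rightarrow> nat \<Rightarrow> nat \<Rightarrow> real) \<Rightarrow> bool" where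
  "scheme_solution P M1 M2 N F \<longleftrightarrow>
     (\<forall>i\<le>M1. \<forall>j\<le>M2. F N i j = terminal P (node_x P M1 i) (node_y P M2 j)) \<and>
     (\<forall>n<N. \<forall>i\<le>M1. \<forall>j\<le>M2.
        let dt = hor P / real N; x = node_x P M1 i; y = node_y P M2 j; t = node_t P N n
        in F n i j = 1 / (4 * (1 + rate P x y t * dt)) *
             (\<Sum>p\<leftarrow>branch_points P dt x y t. interp_sp P M1 M2 (F (Suc n)) (wrap P p)))"

definition error_norm ::
  "periodic_problem \<Rightarrow> (real \<Rightarrow> real \<Rightarrow> real \<Rightarrow> real) \<Rightarrow> nat \<Rightarrow> nat \<Rightarrow> nat \<Rightarrow>
     (nat \<Rightarrow> nat \<Rightarrow> nat \<Rightarrow> real) \<Rightarrow> nat \<Rightarrow> real" where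
  "error_norm P f M1 M2 N F n =
     (MAX (i, j)\<in>{0..M1} \<times> {0..M2}.
        \<bar>F n i j - f (node_x P M1 i) (node_y P M2 j) (node_t P N n)\<bar>)"

end

theory Submission
  imports Defs
begin

text \<open>A step of the scheme is a convex average of values at the next time level, so it does not
  amplify errors; hence the global error is at most the number of steps, \<open>hor P / h\<close>, times the
  error committed in one step, and it suffices that the latter is \<open>O(h\<^sup>2)\<close>.

  Two things contribute to the error of one step. Bilinear interpolation averages over the corners
  of a cell with weights for which the mean corner is the interpolation point, so first-order Taylor
  terms cancel and an error \<open>O(h\<^sup>2)\<close> remains (\<open>interpolation_error\<close>). The average of the exact
  solution over the branch points is handled by \<open>local_truncation_error\<close>: the branch points are
  \<open>q \<plusminus> v\<^sub>1\<close>, \<open>q \<plusminus> v\<^sub>2\<close> around the drifted point \<open>q\<close>, with \<open>v\<^sub>k\<close> of size \<open>sqrt h\<close>. Odd Taylor terms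
  cancel within each pair, leaving second derivatives and a remainder of fourth order in \<open>v\<^sub>k\<close>, that
  is \<open>O(h\<^sup>2)\<close> (\<open>symmetric_second_order_taylor\<close>). The choice of \<open>\<theta>\<close> makes
  \<open>v\<^sub>1 v\<^sub>1\<^sup>T + v\<^sub>2 v\<^sub>2\<^sup>T\<close> equal to \<open>2 h\<close> times the diffusion matrix, and the step from the node \<open>p\<close> to
  \<open>q\<close> produces the time derivative and the drift terms. By the differential equation the sum of
  all terms of order \<open>h\<close> is \<open>h\<close> times the discount term, which is what the factor \<open>1 + r h\<close>
  accounts for. Replacing \<open>h r f\<close> in this way by derivatives of \<open>f\<close> is also why the constant does
  not depend on the size of \<open>r\<close>.

  All estimates take place in one compact box that contains the nodes and every branch point,
  whatever the mesh size; the constants are bounds on derivatives of \<open>f\<close> there. Periodicity enters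
  only through the wrapping of the branch points.\<close>

section \<open>Taylor estimates within a compact convex set\<close>

lemma Ck_on_imp_continuous_on: "Ck_on k S g \<Longrightarrow> continuous_on S g"
  by (cases k) (auto simp: continuous_on_eq_continuous_within dest: has_derivative_continuous)

text \<open>Lets the partial derivatives, and later the coefficients, share one constant.\<close>

lemma uniform_constant:
  fixes \<phi> :: "'b \<Rightarrow> 'x \<Rightarrow> real" and \<psi> :: "'x \<Rightarrow> real"
  assumes fin: "finite B" and ex: "\<And>b. b \<in> B \<Longrightarrow> \<exists>M. \<forall>x\<in>X. \<phi> b x \<le> M * \<psi> x"
    and pos: "\<And>x. x \<in> X \<Longrightarrow> 0 \<le> \<psi> x"
  obtains M where "0 \<le> M" "\<And>b x. b \<in> B \<Longrightarrow> x \<in> X \<Longrightarrow> \<phi> b x \<le> M * \<psi> x"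
proof -
  obtain m where m: "\<forall>b\<in>B. \<forall>x\<in>X. \<phi> b x \<le> m b * \<psi> x"
    using ex by metis
  show thesis
  proof (rule that)
    show "0 \<le> (\<Sum>b\<in>B. \<bar>m b\<bar>)" by (simp add: sum_nonneg)
    fix b x assume b: "b \<in> B" "x \<in> X"
    have "m b \<le> (\<Sum>b\<in>B. \<bar>m b\<bar>)"
      using member_le_sum[of b B "\<lambda>b. \<bar>m b\<bar>"] fin b by auto
    then show "\<phi> b x \<le> (\<Sum>b\<in>B. \<bar>m b\<bar>) * \<psi> x"
      using m b pos[of x] by (meson mult_right_mono order_trans)
  qed
qed

lemma onorm_gradient_le:
  fixes d :: "'a::euclidean_space \<Rightarrow> real" and B :: real
  assumes "\<And>b. b \<in> Basis \<Longrightarrow> \<bar>d b\<bar> \<le> B"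
  shows "onorm (\<lambda>v. \<Sum>b\<in>Basis. (v \<bullet> b) * d b) \<le> DIM('a) * B"
proof (rule onorm_le)
  fix v :: 'a
  have "norm (\<Sum>b\<in>Basis. (v \<bullet> b) * d b) \<le> (\<Sum>b\<in>(Basis::'a set). norm v * B)"
  proof (intro order_trans[OF norm_sum] sum_mono)
    fix b :: 'a assume "b \<in> Basis"
    then have "\<bar>v \<bullet> b\<bar> * \<bar>d b\<bar> \<le> norm v * B"
      by (intro mult_mono) (auto simp: Basis_le_norm assms)
    then show "norm ((v \<bullet> b) * d b) \<le> norm v * B" by (simp add: abs_mult)
  qed
  then show "norm (\<Sum>b\<in>Basis. (v \<bullet> b) * d b) \<le> DIM('a) * B * norm v"
    by (simp add: mult_ac)
qed

lemma C1_lipschitz: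
  fixes g :: "'a::euclidean_space \<Rightarrow> real"
  assumes K: "compact K" "convex K" "K \<subseteq> S" and g: "Ck_on (Suc k) S g"
  shows "\<exists>M. \<forall>z\<in>K\<times>K. \<bar>g (fst z) - g (snd z)\<bar> \<le> M * norm (fst z - snd z)"
proof -
  obtain D where der: "\<And>p. p \<in> S \<Longrightarrow> (g has_derivative (\<lambda>v. \<Sum>b\<in>Basis. (v \<bullet> b) * D b p)) (at p within S)"
    and D: "\<And>b. b \<in> Basis \<Longrightarrow> Ck_on k S (D b)"
    using g by auto
  have "\<exists>M. \<forall>p\<in>K. \<bar>D b p\<bar> \<le> M * 1" if b: "b \<in> Basis" for b
  proof -
    have "continuous_on K (D b)"
      using Ck_on_imp_continuous_on[OF D[OF b]] K continuous_on_subset by blast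
    then have "bounded (D b ` K)"
      using K compact_continuous_image compact_imp_bounded by blast
    then show ?thesis by (auto simp: bounded_iff)
  qed
  then obtain B where "0 \<le> B" and B: "\<And>b p. b \<in> Basis \<Longrightarrow> p \<in> K \<Longrightarrow> \<bar>D b p\<bar> \<le> B * 1"
    by (rule uniform_constant[OF finite_Basis]) (auto simp: that)
  have "norm (g p - g q) \<le> (DIM('a) * B) * norm (p - q)" if "p \<in> K" "q \<in> K" for p q
  proof (rule differentiable_bound[OF K(2) _ _ that])
    show "(g has_derivative (\<lambda>v. \<Sum>b\<in>Basis. (v \<bullet> b) * D b x)) (at x within K)" if "x \<in> K" for x
      using der[of x] that K(3) by (meson has_derivative_subset subsetD)
    show "onorm (\<lambda>v. \<Sum>b\<in>Basis. (v \<bullet> b) * D b x) \<le> DIM('a) * B" if "x \<in> K" for x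
      using B[OF _ that] by (intro onorm_gradient_le) auto
  qed
  then show ?thesis by auto
qed

text \<open>The gradient is Lipschitz on \<open>K\<close>, so along the segment from \<open>p\<close> to \<open>q\<close> it differs from its
  value at \<open>p\<close> by a multiple of the length; the mean value inequality for \<open>g\<close> minus its linear part
  contributes the second factor. The derivatives are within \<open>S\<close>, so \<open>K\<close> may touch the boundary of \<open>S\<close>,
  which is needed at the first and the last time level.\<close>

lemma first_order_taylor:
  fixes g :: "'a::euclidean_space \<Rightarrow> real"
  assumes K: "compact K" "convex K" "K \<subseteq> S"
    and der: "\<And>p. p \<in> S \<Longrightarrow> (g has_derivative (\<lambda>v. \<Sum>b\<in>Basis. (v \<bullet> b) * D b p)) (at p within S)"
    and D: "\<And>b. b \<in> Basis \<Longrightarrow> Ck_on (Suc k) S (D b)"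
  obtains M where "0 \<le> M" "\<And>p q. p \<in> K \<Longrightarrow> q \<in> K \<Longrightarrow>
    \<bar>g q - g p - (\<Sum>b\<in>Basis. ((q - p) \<bullet> b) * D b p)\<bar> \<le> M * (norm (q - p))\<^sup>2"
proof -
  obtain B where B0: "0 \<le> B" and
    B: "\<And>b z. b \<in> (Basis::'a set) \<Longrightarrow> z \<in> K \<times> K \<Longrightarrow>
      \<bar>D b (fst z) - D b (snd z)\<bar> \<le> B * norm (fst z - snd z)"
    by (rule uniform_constant[OF finite_Basis, of "K \<times> K"
            "\<lambda>b z. \<bar>D b (fst z) - D b (snd z)\<bar>" "\<lambda>z. norm (fst z - snd z)"])
      (use C1_lipschitz[OF K D] that in auto)
  have "\<bar>g q - g p - (\<Sum>b\<in>Basis. ((q - p) \<bullet> b) * D b p)\<bar> \<le> (DIM('a) * B) * (norm (q - p))\<^sup>2"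
    if pq: "p \<in> K" "q \<in> K" for p q
  proof -
    let ?L = "\<lambda>x v. \<Sum>b\<in>Basis. (v \<bullet> b) * D b x"
    have sub: "closed_segment p q \<subseteq> K"
      using pq K by (simp add: closed_segment_subset)
    have "norm (g q - g p - ?L p (q - p)) \<le> norm (q - p) * (DIM('a) * (B * norm (q - p)))"
    proof (rule differentiable_bound_linearization[where S = "closed_segment p q"])
      show "p + t *\<^sub>R (q - p) \<in> closed_segment p q" if "t \<in> {0..1}" for t
        using that by (auto simp: in_segment algebra_simps intro!: exI[of _ t])
      show "(g has_derivative ?L x) (at x within closed_segment p q)"
        if "x \<in> closed_segment p q" for x
        using der[of x] that K(3) sub by (meson has_derivative_subset subset_trans subsetD)
      show "onorm (?L x - ?L p) \<le> DIM('a) * (B * norm (q - p))"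
        if x: "x \<in> closed_segment p q" for x
      proof -
        have "?L x - ?L p = (\<lambda>v. \<Sum>b\<in>Basis. (v \<bullet> b) * (D b x - D b p))"
          by (simp add: fun_eq_iff right_diff_distrib sum_subtractf)
        moreover have "\<bar>D b x - D b p\<bar> \<le> B * norm (q - p)" if b: "b \<in> Basis" for b
        proof -
          have "\<bar>D b x - D b p\<bar> \<le> B * norm (x - p)"
            using B[OF b, of "(x, p)"] sub x pq by auto
          also have "\<dots> \<le> B * norm (q - p)"
            using segment_bound(1)[OF x] B0 by (simp add: mult_left_mono)
          finally show ?thesis .
        qed
        ultimately show ?thesis by (simp only: onorm_gradient_le)
      qed
      show "p \<in> closed_segment p q" by simp
    qed
    then show ?thesis by (simp add: power2_eq_square mult_ac)
  qed
  moreover have "0 \<le> DIM('a) * B" using B0 by simp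
  ultimately show thesis by (intro that)
qed

lemma C2_second_difference:
  fixes g :: "'a::euclidean_space \<Rightarrow> real"
  assumes K: "compact K" "convex K" "K \<subseteq> S" and g: "Ck_on (Suc (Suc k)) S g"
  shows "\<exists>M. \<forall>z\<in>{(p, v). p \<in> K \<and> p + v \<in> K \<and> p - v \<in> K}.
    \<bar>g (fst z + snd z) + g (fst z - snd z) - 2 * g (fst z)\<bar> \<le> M * (norm (snd z))\<^sup>2"
proof -
  obtain D where der: "\<And>p. p \<in> S \<Longrightarrow> (g has_derivative (\<lambda>v. \<Sum>b\<in>Basis. (v \<bullet> b) * D b p)) (at p within S)"
    and D: "\<And>b. b \<in> Basis \<Longrightarrow> Ck_on (Suc k) S (D b)"
    using g by (auto simp only: Ck_on.simps(2)[of "Suc k"])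
  obtain M where "0 \<le> M" and M: "\<And>p q. p \<in> K \<Longrightarrow> q \<in> K \<Longrightarrow>
    \<bar>g q - g p - (\<Sum>b\<in>Basis. ((q - p) \<bullet> b) * D b p)\<bar> \<le> M * (norm (q - p))\<^sup>2"
    using first_order_taylor[OF K der D] by blast
  have "\<bar>g (p + v) + g (p - v) - 2 * g p\<bar> \<le> (2 * M) * (norm v)\<^sup>2"
    if "p \<in> K" "p + v \<in> K" "p - v \<in> K" for p v
    using M[of p "p + v"] M[of p "p - v"] that by (simp add: sum_negf)
  then show ?thesis by auto
qed

lemma taylor_remainder_le:
  fixes \<psi> :: "real \<Rightarrow> real"
  assumes d1: "\<And>s. s \<in> {0..1} \<Longrightarrow> (\<psi> has_real_derivative \<psi>' s) (at s within {0..1})"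
    and d2: "\<And>s. s \<in> {0..1} \<Longrightarrow> (\<psi>' has_real_derivative \<psi>'' s) (at s within {0..1})"
    and B: "\<And>s. s \<in> {0..1} \<Longrightarrow> \<bar>\<psi>'' s\<bar> \<le> B" and 0: "\<psi> 0 = 0" "\<psi>' 0 = 0"
  shows "\<bar>\<psi> 1\<bar> \<le> B"
proof -
  have B0: "0 \<le> B" using B[of 0] by simp
  have "norm (\<psi>' s) \<le> B" if s: "s \<in> {0..1}" for s
  proof -
    have "norm (\<psi>' s - \<psi>' 0) \<le> B * norm (s - 0)"
      by (rule field_differentiable_bound[where S = "{0..1}" and f' = \<psi>'']) (use d2 B s in auto)
    also have "\<dots> \<le> B" using s B0 by (simp add: mult_left_le)
    finally show ?thesis using 0 by simp
  qed
  then have "norm (\<psi> 1 - \<psi> 0) \<le> B * norm (1 - 0 :: real)"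
    by (intro field_differentiable_bound[where S = "{0..1}" and f' = \<psi>']) (use d1 in auto)
  then show ?thesis using 0 by simp
qed

lemma has_real_derivative_along_line:
  fixes g :: "'a::euclidean_space \<Rightarrow> real"
  assumes der: "(g has_derivative (\<lambda>v. \<Sum>b\<in>Basis. (v \<bullet> b) * d b)) (at (p + s *\<^sub>R v) within S)"
    and sub: "\<And>t. t \<in> T \<Longrightarrow> p + t *\<^sub>R v \<in> S"
  shows "((\<lambda>t. g (p + t *\<^sub>R v)) has_real_derivative (\<Sum>b\<in>Basis. (v \<bullet> b) * d b)) (at s within T)"
proof -
  have "((\<lambda>t. p + t *\<^sub>R v) has_derivative (\<lambda>t. t *\<^sub>R v)) (at s within T)"
    by (auto intro!: derivative_eq_intros)
  moreover have "(g has_derivative (\<lambda>v. \<Sum>b\<in>Basis. (v \<bullet> b) * d b))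
      (at (p + s *\<^sub>R v) within (\<lambda>t. p + t *\<^sub>R v) ` T)"
    using der sub by (auto intro: has_derivative_subset)
  ultimately have "((g \<circ> (\<lambda>t. p + t *\<^sub>R v)) has_derivative
      ((\<lambda>v. \<Sum>b\<in>Basis. (v \<bullet> b) * d b) \<circ> (\<lambda>t. t *\<^sub>R v))) (at s within T)"
    by (rule diff_chain_within)
  moreover have "(\<lambda>v. \<Sum>b\<in>Basis. (v \<bullet> b) * d b) \<circ> (\<lambda>t. t *\<^sub>R v) = (*) (\<Sum>b\<in>Basis. (v \<bullet> b) * d b)"
    by (simp add: fun_eq_iff sum_distrib_left mult_ac)
  ultimately show ?thesis
    by (simp add: o_def has_field_derivative_def)
qed

text \<open>Restricted to the line through \<open>p\<close> in direction \<open>v\<close>, the left-hand side vanishes at \<open>0\<close>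
  together with its first derivative, and its second derivative is a symmetric second difference of
  the Hessian applied to \<open>v\<close>. The linear terms of the Hessian cancel in this difference, which gives two
  more powers of \<open>v\<close>.\<close>

lemma symmetric_second_order_taylor:
  fixes g :: "'a::euclidean_space \<Rightarrow> real"
  assumes K: "compact K" "convex K" "K \<subseteq> S"
    and d1: "\<And>p. p \<in> S \<Longrightarrow> (g has_derivative (\<lambda>v. \<Sum>b\<in>Basis. (v \<bullet> b) * D b p)) (at p within S)"
    and d2: "\<And>b p. b \<in> Basis \<Longrightarrow> p \<in> S \<Longrightarrow>
      (D b has_derivative (\<lambda>v. \<Sum>c\<in>Basis. (v \<bullet> c) * D2 b c p)) (at p within S)"
    and D2: "\<And>b c. b \<in> Basis \<Longrightarrow> c \<in> Basis \<Longrightarrow> Ck_on (Suc (Suc k)) S (D2 b c)"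
  obtains M where "0 \<le> M" "\<And>p v. p \<in> K \<Longrightarrow> p + v \<in> K \<Longrightarrow> p - v \<in> K \<Longrightarrow>
    \<bar>g (p + v) + g (p - v) - 2 * g p
      - (\<Sum>b\<in>Basis. \<Sum>c\<in>Basis. (v \<bullet> b) * (v \<bullet> c) * D2 b c p)\<bar> \<le> M * norm v ^ 4"
proof -
  let ?X = "{(p, v). p \<in> K \<and> p + v \<in> K \<and> p - v \<in> K}"
  let ?\<delta> = "\<lambda>e z. \<bar>D2 (fst e) (snd e) (fst z + snd z) + D2 (fst e) (snd e) (fst z - snd z)
    - 2 * D2 (fst e) (snd e) (fst z)\<bar>"
  have ex: "\<exists>M. \<forall>z\<in>?X. ?\<delta> e z \<le> M * (norm (snd z))\<^sup>2" if "e \<in> Basis \<times> Basis" for e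
    using C2_second_difference[OF K D2, of "fst e" "snd e"] that by (simp only: mem_Times_iff)
  obtain B where B0: "0 \<le> B"
    and B: "\<And>e z. e \<in> Basis \<times> Basis \<Longrightarrow> z \<in> ?X \<Longrightarrow> ?\<delta> e z \<le> B * (norm (snd z))\<^sup>2"
    by (rule uniform_constant[of "Basis \<times> Basis" ?X ?\<delta> "\<lambda>z. (norm (snd z))\<^sup>2"])
      (blast intro: ex finite_cartesian_product finite_Basis zero_le_power2)+
  have "\<bar>g (p + v) + g (p - v) - 2 * g p
      - (\<Sum>b\<in>Basis. \<Sum>c\<in>Basis. (v \<bullet> b) * (v \<bullet> c) * D2 b c p)\<bar>
      \<le> (real (DIM('a) * DIM('a)) * B) * norm v ^ 4"
    if pv: "p \<in> K" "p + v \<in> K" "p - v \<in> K" for p v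
  proof -
    define H where "H s = (\<Sum>b\<in>Basis. \<Sum>c\<in>Basis. (v \<bullet> b) * (v \<bullet> c) * D2 b c (p + s *\<^sub>R v))" for s
    define G where "G s = (\<Sum>b\<in>Basis. (v \<bullet> b) * D b (p + s *\<^sub>R v))" for s
    have line: "p + s *\<^sub>R v \<in> K" if "s \<in> {-1..1}" for s
    proof -
      have "p + s *\<^sub>R v = (1 - (1 + s) / 2) *\<^sub>R (p - v) + ((1 + s) / 2) *\<^sub>R (p + v)"
        by (rule euclidean_eqI) (simp add: inner_simps field_simps)
      then show ?thesis
        using convexD_alt[OF K(2) pv(3,2), of "(1 + s) / 2"] that by auto
    qed
    have neg: "- s \<in> {-1..1}" "s \<in> {-1..1}" if "s \<in> {0..1}" for s :: real using that by auto
    have g1: "((\<lambda>t. g (p + t *\<^sub>R v)) has_real_derivative G s) (at s within {-1..1})"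
      if "s \<in> {-1..1}" for s
      unfolding G_def using line that K(3) by (intro has_real_derivative_along_line[OF d1]) auto
    have g2: "(G has_real_derivative H s) (at s within {-1..1})"
      if "s \<in> {-1..1}" for s
    proof -
      have "((\<lambda>t. D b (p + t *\<^sub>R v)) has_real_derivative
          (\<Sum>c\<in>Basis. (v \<bullet> c) * D2 b c (p + s *\<^sub>R v))) (at s within {-1..1})" if b: "b \<in> Basis" for b
        using line \<open>s \<in> {-1..1}\<close> K(3)
        by (intro has_real_derivative_along_line[OF d2[OF b]]) auto
      then show ?thesis
        unfolding G_def H_def
        by (auto intro!: derivative_eq_intros sum.cong simp: sum_distrib_left mult_ac)
    qed
    have reflect: "((\<lambda>t. \<phi> (- t)) has_real_derivative - \<phi>' (- s)) (at s within {0..1})"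
      if "\<And>s. s \<in> {-1..1} \<Longrightarrow> (\<phi> has_real_derivative \<phi>' s) (at s within {-1..1})" "s \<in> {0..1}"
      for \<phi> \<phi>' :: "real \<Rightarrow> real" and s
    proof -
      have "(\<phi> has_real_derivative \<phi>' (- s)) (at (- s) within uminus ` {0..1})"
        by (rule DERIV_subset[OF that(1)]) (use that(2) in auto)
      moreover have "(uminus has_real_derivative - 1) (at s within {0..1})"
        by (auto intro!: derivative_eq_intros)
      ultimately have "(\<phi> \<circ> uminus has_real_derivative \<phi>' (- s) * - 1) (at s within {0..1})"
        by (intro DERIV_image_chain)
      then show ?thesis by (simp add: o_def)
    qed
    have half: "(\<phi> has_real_derivative d) (at s within {0..1})"
      if "(\<phi> has_real_derivative d) (at s within {-1..1})" for \<phi> d and s :: real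
      using that by (rule DERIV_subset) auto
    have H_bound: "\<bar>H s + H (- s) - 2 * H 0\<bar> \<le> real (DIM('a) * DIM('a)) * B * norm v ^ 4"
      if s: "s \<in> {0..1}" for s
    proof -
      let ?d = "\<lambda>b c. D2 b c (p + s *\<^sub>R v) + D2 b c (p - s *\<^sub>R v) - 2 * D2 b c p"
      have "\<bar>(v \<bullet> b) * (v \<bullet> c) * ?d b c\<bar> \<le> B * norm v ^ 4"
        if bc: "b \<in> Basis" "c \<in> Basis" for b c
      proof -
        have "\<bar>?d b c\<bar> \<le> B * (norm (s *\<^sub>R v))\<^sup>2"
          using B[of "(b, c)" "(p, s *\<^sub>R v)"] bc pv line[of s] line[of "- s"] s by auto
        also have "\<dots> \<le> B * (norm v)\<^sup>2"
          using s B0 by (auto intro!: mult_left_mono power_mono mult_left_le_one_le)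
        finally have "\<bar>?d b c\<bar> \<le> B * (norm v)\<^sup>2" .
        then have "\<bar>v \<bullet> b\<bar> * \<bar>v \<bullet> c\<bar> * \<bar>?d b c\<bar> \<le> norm v * norm v * (B * (norm v)\<^sup>2)"
          using bc by (intro mult_mono) (auto simp: Basis_le_norm)
        then show ?thesis by (simp add: abs_mult power2_eq_square power4_eq_xxxx mult_ac)
      qed
      then have "(\<Sum>b\<in>Basis. \<Sum>c\<in>Basis. \<bar>(v \<bullet> b) * (v \<bullet> c) * ?d b c\<bar>)
          \<le> (\<Sum>b\<in>(Basis::'a set). \<Sum>c\<in>(Basis::'a set). B * norm v ^ 4)"
        by (intro sum_mono) auto
      moreover have "H s + H (- s) - 2 * H 0 = (\<Sum>b\<in>Basis. \<Sum>c\<in>Basis. (v \<bullet> b) * (v \<bullet> c) * ?d b c)"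
        unfolding H_def by (simp add: sum.distrib sum_subtractf sum_distrib_left algebra_simps)
      moreover have "\<bar>\<Sum>b\<in>Basis. \<Sum>c\<in>Basis. (v \<bullet> b) * (v \<bullet> c) * ?d b c\<bar>
          \<le> (\<Sum>b\<in>Basis. \<Sum>c\<in>Basis. \<bar>(v \<bullet> b) * (v \<bullet> c) * ?d b c\<bar>)"
        by (intro order_trans[OF sum_abs] sum_mono sum_abs)
      ultimately show ?thesis by (simp add: mult_ac)
    qed
    let ?\<psi> = "\<lambda>s. g (p + s *\<^sub>R v) + g (p + (- s) *\<^sub>R v) - 2 * g p - s\<^sup>2 * H 0"
    have "\<bar>?\<psi> 1\<bar> \<le> real (DIM('a) * DIM('a)) * B * norm v ^ 4"
    proof (rule taylor_remainder_le[where \<psi> = ?\<psi> and \<psi>' = "\<lambda>s. G s - G (- s) - 2 * s * H 0"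
          and \<psi>'' = "\<lambda>s. H s + H (- s) - 2 * H 0", OF _ _ H_bound])
      fix s :: real assume s: "s \<in> {0..1}"
      have fwd: "((\<lambda>s. g (p + s *\<^sub>R v)) has_real_derivative G s) (at s within {0..1})"
        "(G has_real_derivative H s) (at s within {0..1})"
        by (rule half[OF g1[OF neg(2)[OF s]]], rule half[OF g2[OF neg(2)[OF s]]])
      have bwd: "((\<lambda>s. g (p + (- s) *\<^sub>R v)) has_real_derivative - G (- s)) (at s within {0..1})"
        "((\<lambda>s. G (- s)) has_real_derivative - H (- s)) (at s within {0..1})"
        using reflect[OF g1 s] reflect[OF g2 s] by auto
      have "((\<lambda>s. s\<^sup>2 * H 0) has_real_derivative 2 * s * H 0) (at s within {0..1})"
        by (auto intro!: derivative_eq_intros)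
      from DERIV_diff[OF DERIV_diff[OF DERIV_add[OF fwd(1) bwd(1)] DERIV_const[of "2 * g p"]] this]
      show "((\<lambda>s. g (p + s *\<^sub>R v) + g (p + (- s) *\<^sub>R v) - 2 * g p - s\<^sup>2 * H 0)
          has_real_derivative G s - G (- s) - 2 * s * H 0) (at s within {0..1})"
        by simp
      have "((\<lambda>s. 2 * s * H 0) has_real_derivative 2 * H 0) (at s within {0..1})"
        by (auto intro!: derivative_eq_intros)
      from DERIV_diff[OF DERIV_diff[OF fwd(2) bwd(2)] this]
      show "((\<lambda>s. G s - G (- s) - 2 * s * H 0) has_real_derivative H s + H (- s) - 2 * H 0)
          (at s within {0..1})"
        by simp
    qed simp_all
    then show ?thesis by (simp add: H_def)
  qed
  moreover have "0 \<le> real (DIM('a) * DIM('a)) * B" using B0 by simp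
  ultimately show thesis by (intro that)
qed

text \<open>The mixed difference is the increment over \<open>[0, h]\<close> of
  \<open>u \<mapsto> g (p + h c + u b) - g (p + u b)\<close>, whose derivative is a difference of the partial
  derivative \<open>D b\<close> in direction \<open>c\<close>, hence \<open>h * D2 c p + O(h\<^sup>2)\<close>.\<close>

lemma mixed_second_difference:
  fixes g :: "'a::euclidean_space \<Rightarrow> real"
  assumes K: "compact K" "convex K" "K \<subseteq> S"
    and d1: "\<And>p. p \<in> S \<Longrightarrow> (g has_derivative (\<lambda>v. \<Sum>b\<in>Basis. (v \<bullet> b) * D b p)) (at p within S)"
    and d2: "\<And>p. p \<in> S \<Longrightarrow>
      (D b has_derivative (\<lambda>v. \<Sum>c\<in>Basis. (v \<bullet> c) * D2 c p)) (at p within S)"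
    and D2: "\<And>c. c \<in> Basis \<Longrightarrow> Ck_on (Suc k) S (D2 c)"
    and bc: "b \<in> Basis" "c \<in> Basis" "b \<noteq> c"
    and box: "\<And>s t. s \<in> {0..1} \<Longrightarrow> t \<in> {0..1} \<Longrightarrow> p + s *\<^sub>R b + t *\<^sub>R c \<in> K"
  obtains M where "\<And>h. h \<in> {0..1} \<Longrightarrow> \<bar>g (p + h *\<^sub>R b + h *\<^sub>R c) - g (p + h *\<^sub>R b) - g (p + h *\<^sub>R c) + g p
    - h\<^sup>2 * D2 c p\<bar> \<le> M * h ^ 3"
proof -
  obtain M where M0: "0 \<le> M" and M: "\<And>p q. p \<in> K \<Longrightarrow> q \<in> K \<Longrightarrow>
    \<bar>D b q - D b p - (\<Sum>c\<in>Basis. ((q - p) \<bullet> c) * D2 c p)\<bar> \<le> M * (norm (q - p))\<^sup>2"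
    using first_order_taylor[OF K d2 D2] by blast
  have pick: "(\<Sum>c'\<in>Basis. ((s *\<^sub>R b + t *\<^sub>R c) \<bullet> c') * d c') = s * d b + t * d c" for s t d
  proof -
    have "(\<Sum>c'\<in>Basis. ((s *\<^sub>R b + t *\<^sub>R c) \<bullet> c') * d c')
        = (\<Sum>c'\<in>Basis. (if c' = b then s * d c' else 0) + (if c' = c then t * d c' else 0))"
      by (rule sum.cong) (auto simp: inner_add_left inner_Basis bc)
    then show ?thesis using bc by (simp add: sum.distrib)
  qed
  have "\<bar>g (p + h *\<^sub>R b + h *\<^sub>R c) - g (p + h *\<^sub>R b) - g (p + h *\<^sub>R c) + g p - h\<^sup>2 * D2 c p\<bar> \<le> (5 * M) * h ^ 3"
    if h: "h \<in> {0..1}" for h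
  proof -
    let ?\<Phi> = "\<lambda>u. g (p + h *\<^sub>R c + u *\<^sub>R b) - g (p + u *\<^sub>R b) - u * (h * D2 c p)"
    let ?\<Phi>' = "\<lambda>u. D b (p + h *\<^sub>R c + u *\<^sub>R b) - D b (p + u *\<^sub>R b) - h * D2 c p"
    have inK: "p + h *\<^sub>R c + u *\<^sub>R b \<in> K" "p + u *\<^sub>R b \<in> K" "p \<in> K" if "u \<in> {0..h}" for u
      using box[of u h] box[of u 0] box[of 0 0] that h by (auto simp: algebra_simps)
    have "norm (?\<Phi> h - ?\<Phi> 0) \<le> (5 * M * h\<^sup>2) * norm (h - 0)"
    proof (rule field_differentiable_bound[where S = "{0..h}" and f' = ?\<Phi>'])
      fix u assume u: "u \<in> {0..h}"
      have "((\<lambda>t. g (p + h *\<^sub>R c + t *\<^sub>R b)) has_real_derivative D b (p + h *\<^sub>R c + u *\<^sub>R b)) (at u within {0..h})"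
        using has_real_derivative_along_line[OF d1[of "p + h *\<^sub>R c + u *\<^sub>R b"], of "{0..h}"]
          pick[of 1 0] inK u subsetD[OF K(3)] by auto
      moreover have "((\<lambda>t. g (p + t *\<^sub>R b)) has_real_derivative D b (p + u *\<^sub>R b)) (at u within {0..h})"
        using has_real_derivative_along_line[OF d1[of "p + u *\<^sub>R b"], of "{0..h}"]
          pick[of 1 0] inK u subsetD[OF K(3)] by auto
      ultimately show "(?\<Phi> has_real_derivative ?\<Phi>' u) (at u within {0..h})"
        by (auto intro!: derivative_eq_intros)
      have "norm (u *\<^sub>R b + h *\<^sub>R c) \<le> 2 * h"
        using norm_triangle_ineq[of "u *\<^sub>R b" "h *\<^sub>R c"] u h bc by auto
      then have "(norm (u *\<^sub>R b + h *\<^sub>R c))\<^sup>2 \<le> (2 * h)\<^sup>2" by (intro power_mono) auto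
      then have 1: "M * (norm (u *\<^sub>R b + h *\<^sub>R c))\<^sup>2 \<le> M * (4 * h\<^sup>2)"
        using M0 by (intro mult_left_mono) (auto simp: power_mult_distrib)
      have "(norm (u *\<^sub>R b))\<^sup>2 \<le> h\<^sup>2" using u bc by (auto intro!: power_mono)
      then have 2: "M * (norm (u *\<^sub>R b))\<^sup>2 \<le> M * h\<^sup>2"
        using M0 by (intro mult_left_mono)
      have "\<bar>D b (p + h *\<^sub>R c + u *\<^sub>R b) - D b p - (u * D2 b p + h * D2 c p)\<bar>
          \<le> M * (norm (u *\<^sub>R b + h *\<^sub>R c))\<^sup>2"
        using M[OF inK(3) inK(1), OF u u] pick[of u h "\<lambda>c. D2 c p"] by (simp add: algebra_simps)
      moreover have "\<bar>D b (p + u *\<^sub>R b) - D b p - u * D2 b p\<bar> \<le> M * (norm (u *\<^sub>R b))\<^sup>2"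
        using M[OF inK(3) inK(2), OF u u] pick[of u 0 "\<lambda>c. D2 c p"] by simp
      ultimately show "norm (?\<Phi>' u) \<le> 5 * M * h\<^sup>2"
        using 1 2 by simp
    qed (use h in auto)
    moreover have "5 * M * h\<^sup>2 * norm (h - 0) = 5 * M * h ^ 3"
      using h by (simp add: power2_eq_square power3_eq_cube)
    moreover have "?\<Phi> h - ?\<Phi> 0 = g (p + h *\<^sub>R b + h *\<^sub>R c) - g (p + h *\<^sub>R b) - g (p + h *\<^sub>R c) + g p - h\<^sup>2 * D2 c p"
      by (simp add: power2_eq_square algebra_simps)
    ultimately show ?thesis by (simp only: real_norm_def)
  qed
  then show thesis by (rule that)
qed

text \<open>The mixed difference is symmetric in \<open>b\<close> and \<open>c\<close>, so both mixed partials are its limit after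
  division by \<open>h\<^sup>2\<close>. Only increments with nonnegative coefficients are used, so that \<open>p\<close> may lie on the
  boundary.\<close>

lemma mixed_partials_commute:
  fixes g :: "'a::euclidean_space \<Rightarrow> real"
  assumes K: "compact K" "convex K" "K \<subseteq> S"
    and d1: "\<And>p. p \<in> S \<Longrightarrow> (g has_derivative (\<lambda>v. \<Sum>b\<in>Basis. (v \<bullet> b) * D b p)) (at p within S)"
    and d2: "\<And>b p. b \<in> Basis \<Longrightarrow> p \<in> S \<Longrightarrow>
      (D b has_derivative (\<lambda>v. \<Sum>c\<in>Basis. (v \<bullet> c) * D2 b c p)) (at p within S)"
    and D2: "\<And>b c. b \<in> Basis \<Longrightarrow> c \<in> Basis \<Longrightarrow> Ck_on (Suc k) S (D2 b c)"
    and bc: "b \<in> Basis" "c \<in> Basis"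
    and box: "\<And>s t. s \<in> {0..1} \<Longrightarrow> t \<in> {0..1} \<Longrightarrow> p + s *\<^sub>R b + t *\<^sub>R c \<in> K"
  shows "D2 b c p = D2 c b p"
proof (cases "b = c")
  case False
  obtain M1 where M1: "\<And>h. h \<in> {0..1} \<Longrightarrow> \<bar>g (p + h *\<^sub>R b + h *\<^sub>R c) - g (p + h *\<^sub>R b)
      - g (p + h *\<^sub>R c) + g p - h\<^sup>2 * D2 b c p\<bar> \<le> M1 * h ^ 3"
    using mixed_second_difference[OF K d1 d2[OF bc(1)] D2[OF bc(1)] bc False box] by blast
  have box': "p + s *\<^sub>R c + t *\<^sub>R b \<in> K" if "s \<in> {0..1}" "t \<in> {0..1}" for s t
    using box[OF that(2,1)] by (simp add: algebra_simps)
  obtain M2 where M2: "\<And>h. h \<in> {0..1} \<Longrightarrow> \<bar>g (p + h *\<^sub>R c + h *\<^sub>R b) - g (p + h *\<^sub>R c)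
      - g (p + h *\<^sub>R b) + g p - h\<^sup>2 * D2 c b p\<bar> \<le> M2 * h ^ 3"
    using mixed_second_difference[OF K d1 d2[OF bc(2)] D2[OF bc(2)] bc(2,1) False[symmetric] box'] by blast
  have le: "\<bar>D2 b c p - D2 c b p\<bar> \<le> (M1 + M2) * h" if h: "h \<in> {0<..1}" for h
  proof -
    have "p + h *\<^sub>R c + h *\<^sub>R b = p + h *\<^sub>R b + h *\<^sub>R c" by (simp add: algebra_simps)
    with M2[of h] h have "\<bar>g (p + h *\<^sub>R b + h *\<^sub>R c) - g (p + h *\<^sub>R c) - g (p + h *\<^sub>R b) + g p - h\<^sup>2 * D2 c b p\<bar> \<le> M2 * h ^ 3"
      by (metis greaterThanAtMost_subseteq_atLeastAtMost_iff order_refl subsetD)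
    then have "\<bar>h\<^sup>2 * D2 b c p - h\<^sup>2 * D2 c b p\<bar> \<le> M1 * h ^ 3 + M2 * h ^ 3"
      using M1[of h] h by (simp add: abs_le_iff)
    moreover have "\<bar>h\<^sup>2 * D2 b c p - h\<^sup>2 * D2 c b p\<bar> = h\<^sup>2 * \<bar>D2 b c p - D2 c b p\<bar>"
      by (simp add: abs_mult flip: right_diff_distrib)
    moreover have "M1 * h ^ 3 + M2 * h ^ 3 = h\<^sup>2 * ((M1 + M2) * h)"
      by (simp add: power2_eq_square power3_eq_cube algebra_simps)
    ultimately show ?thesis using h by auto
  qed
  have "((\<lambda>h. (M1 + M2) * h) \<longlongrightarrow> (M1 + M2) * 0) (at_right 0)"
    by (intro tendsto_intros)
  moreover have "\<forall>\<^sub>F h in at_right 0. \<bar>D2 b c p - D2 c b p\<bar> \<le> (M1 + M2) * h"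
    using eventually_at_right_real[OF zero_less_one] by eventually_elim (use le in auto)
  ultimately have "\<bar>D2 b c p - D2 c b p\<bar> \<le> (M1 + M2) * 0"
    by (intro tendsto_lowerbound) auto
  then show ?thesis by simp
qed simp

section \<open>Bilinear interpolation and wrapping\<close>

lemma cell_coordinate:
  fixes h :: real
  assumes h: "0 < h" and x: "lo \<le> x" "x < lo + real M * h" and i: "i = nat \<lfloor>(x - lo) / h\<rfloor>"
    and a: "a = (x - (lo + real i * h)) / h"
  shows "i < M" "a \<in> {0..1}" "x = lo + real i * h + a * h"
proof -
  have 0: "0 \<le> (x - lo) / h" using h x by simp
  then have i': "real i = of_int \<lfloor>(x - lo) / h\<rfloor>" using i by simp
  have up: "(x - lo) / h < real M" using x h by (simp add: field_simps)
  then have "real i < real M" using i' by linarith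
  then show "i < M" by simp
  show "x = lo + real i * h + a * h" using h a by simp
  have "a = (x - lo) / h - real i" using h a by (simp add: field_simps)
  then show "a \<in> {0..1}" using i' by (simp, linarith)
qed

text \<open>The cell and the weights depend only on the point, not on the grid values: one cell serves
  for both arguments when two interpolants are compared.\<close>

lemma interp_sp_cell:
  assumes P: "xlo P < xhi P" "ylo P < yhi P" and M: "0 < M1" "0 < M2"
    and X: "X \<in> {xlo P..<xhi P}" and Y: "Y \<in> {ylo P..<yhi P}"
  obtains i j a b where "i < M1" "j < M2" "a \<in> {0..1}" "b \<in> {0..1}"
    "X = node_x P M1 i + a * (Lx P / real M1)" "Y = node_y P M2 j + b * (Ly P / real M2)"
    "\<And>G. interp_sp P M1 M2 G (X, Y) = (1 - a) * (1 - b) * G i j + a * (1 - b) * G (Suc i) j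
        + (1 - a) * b * G i (Suc j) + a * b * G (Suc i) (Suc j)"
proof -
  define i j where "i = nat \<lfloor>(X - xlo P) / (Lx P / real M1)\<rfloor>" and "j = nat \<lfloor>(Y - ylo P) / (Ly P / real M2)\<rfloor>"
  define a b where "a = (X - node_x P M1 i) / (Lx P / real M1)"
    and "b = (Y - node_y P M2 j) / (Ly P / real M2)"
  have hpos: "0 < Lx P / real M1" "0 < Ly P / real M2"
    using P M by (auto simp: Lx_def Ly_def)
  have up: "X < xlo P + real M1 * (Lx P / real M1)" "Y < ylo P + real M2 * (Ly P / real M2)"
    using X Y M by (auto simp: Lx_def Ly_def)
  have 1: "i < M1" "a \<in> {0..1}" "X = node_x P M1 i + a * (Lx P / real M1)"
    using cell_coordinate[OF hpos(1) _ up(1) i_def a_def[unfolded node_x_def]] X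
    by (auto simp: node_x_def)
  have 2: "j < M2" "b \<in> {0..1}" "Y = node_y P M2 j + b * (Ly P / real M2)"
    using cell_coordinate[OF hpos(2) _ up(2) j_def b_def[unfolded node_y_def]] Y
    by (auto simp: node_y_def)
  have "interp_sp P M1 M2 G (X, Y) = (1 - a) * (1 - b) * G i j + a * (1 - b) * G (Suc i) j
        + (1 - a) * b * G i (Suc j) + a * b * G (Suc i) (Suc j)" for G
    unfolding interp_sp_def i_def a_def j_def b_def Let_def by simp
  then show thesis using that 1 2 by blast
qed

lemma bilinear_average_le:
  fixes a b :: real
  assumes ab: "a \<in> {0..1}" "b \<in> {0..1}"
    and z: "\<bar>z1\<bar> \<le> E" "\<bar>z2\<bar> \<le> E" "\<bar>z3\<bar> \<le> E" "\<bar>z4\<bar> \<le> E"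
  shows "\<bar>(1 - a) * (1 - b) * z1 + a * (1 - b) * z2 + (1 - a) * b * z3 + a * b * z4\<bar> \<le> E"
proof -
  have bound: "\<bar>w * z\<bar> \<le> w * E" if "0 \<le> w" "\<bar>z\<bar> \<le> E" for w z
    using that by (simp add: abs_mult mult_left_mono)
  have "\<bar>(1 - a) * (1 - b) * z1\<bar> \<le> (1 - a) * (1 - b) * E" "\<bar>a * (1 - b) * z2\<bar> \<le> a * (1 - b) * E"
    "\<bar>(1 - a) * b * z3\<bar> \<le> (1 - a) * b * E" "\<bar>a * b * z4\<bar> \<le> a * b * E"
    using ab z by (auto intro!: bound)
  moreover have "(1 - a) * (1 - b) * E + a * (1 - b) * E + (1 - a) * b * E + a * b * E = E"
    by (simp add: algebra_simps)
  ultimately show ?thesis by linarith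
qed

lemma interp_sp_diff_le:
  assumes P: "xlo P < xhi P" "ylo P < yhi P" and M: "0 < M1" "0 < M2"
    and X: "X \<in> {xlo P..<xhi P}" and Y: "Y \<in> {ylo P..<yhi P}"
    and E: "\<And>i j. i \<le> M1 \<Longrightarrow> j \<le> M2 \<Longrightarrow> \<bar>F i j - G i j\<bar> \<le> E"
  shows "\<bar>interp_sp P M1 M2 F (X, Y) - interp_sp P M1 M2 G (X, Y)\<bar> \<le> E"
proof -
  obtain i j a b where ij: "i < M1" "j < M2" and ab: "a \<in> {0..1}" "b \<in> {0..1}"
    and "X = node_x P M1 i + a * (Lx P / real M1)" "Y = node_y P M2 j + b * (Ly P / real M2)"
    and I: "\<And>G. interp_sp P M1 M2 G (X, Y) = (1 - a) * (1 - b) * G i j + a * (1 - b) * G (Suc i) j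
        + (1 - a) * b * G i (Suc j) + a * b * G (Suc i) (Suc j)"
    using interp_sp_cell[OF P M X Y] by metis
  have "interp_sp P M1 M2 F (X, Y) - interp_sp P M1 M2 G (X, Y)
    = (1 - a) * (1 - b) * (F i j - G i j) + a * (1 - b) * (F (Suc i) j - G (Suc i) j)
        + (1 - a) * b * (F i (Suc j) - G i (Suc j)) + a * b * (F (Suc i) (Suc j) - G (Suc i) (Suc j))"
    unfolding I by (simp add: algebra_simps)
  also have "\<bar>\<dots>\<bar> \<le> E"
    using ij by (intro bilinear_average_le ab E) auto
  finally show ?thesis .
qed

lemma rmod_representative:
  assumes "0 < L"
  shows "\<exists>k::int. lo + (x - lo) rmod L = x + of_int k * L"
  using assms by (intro exI[of _ "- \<lfloor>(x - lo) / L\<rfloor>"]) (simp add: rmod_def algebra_simps)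

lemma periodic_of_int:
  fixes \<phi> :: "real \<Rightarrow> 'b"
  assumes per: "\<And>x. \<phi> (x + L) = \<phi> x"
  shows "\<phi> (x + of_int k * L) = \<phi> x"
proof (induction k rule: int_induct[where k = 0])
  case (step1 i)
  have "\<phi> (x + of_int (i + 1) * L) = \<phi> (x + of_int i * L + L)" by (simp add: algebra_simps)
  then show ?case using step1 per by simp
next
  case (step2 i)
  have "\<phi> (x + of_int i * L) = \<phi> (x + of_int (i - 1) * L + L)" by (simp add: algebra_simps)
  then show ?case using step2 per by simp
qed simp

lemma wrap_in_rectangle:
  assumes P: "xlo P < xhi P" "ylo P < yhi P"
  shows "fst (wrap P p) \<in> {xlo P..<xhi P}" "snd (wrap P p) \<in> {ylo P..<yhi P}"
  using rmod_nonneg[of "Lx P" "fst p - xlo P"] rmod_less[of "Lx P" "fst p - xlo P"]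
    rmod_nonneg[of "Ly P" "snd p - ylo P"] rmod_less[of "Ly P" "snd p - ylo P"] P
  by (auto simp: wrap_def Lx_def Ly_def split: prod.splits)

lemma doubly_periodic_wrap:
  assumes P: "xlo P < xhi P" "ylo P < yhi P" and g: "doubly_periodic P g"
  shows "g (fst (wrap P p)) (snd (wrap P p)) = g (fst p) (snd p)"
proof -
  obtain x y where p: "p = (x, y)" by (cases p)
  have L: "0 < Lx P" "0 < Ly P" using P by (auto simp: Lx_def Ly_def)
  obtain k l where "xlo P + (x - xlo P) rmod Lx P = x + of_int k * Lx P"
    and "ylo P + (y - ylo P) rmod Ly P = y + of_int l * Ly P"
    using rmod_representative[OF L(1)] rmod_representative[OF L(2)] by blast
  moreover have "g (x + of_int k * Lx P) (y + of_int l * Ly P) = g x (y + of_int l * Ly P)"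
    using periodic_of_int[of "\<lambda>x. g x (y + of_int l * Ly P)"] g by (simp add: doubly_periodic_def)
  moreover have "g x (y + of_int l * Ly P) = g x y"
    using periodic_of_int[of "g x"] g by (simp add: doubly_periodic_def)
  ultimately show ?thesis by (simp add: p wrap_def)
qed

lemma sum_Basis_space_time:
  "(\<Sum>b\<in>Basis. \<phi> b) = \<phi> (1, 0, 0) + \<phi> (0, 1, 0) + \<phi> ((0, 0, 1) :: real \<times> real \<times> real)"
  by (simp add: Basis_prod_def zero_prod_def add_ac)

lemma norm_space_time_le: "norm (x::real, y::real, t::real) \<le> \<bar>x\<bar> + \<bar>y\<bar> + \<bar>t\<bar>"
  using norm_Pair_le[of x "(y, t)"] norm_Pair_le[of y t] by simp

text \<open>The four corners averaged with the bilinear weights give back the interpolation point, so the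
  values and the first-order terms of the Taylor expansion around that point are reproduced exactly, and
  the error is a convex combination of quadratic remainders.\<close>

lemma interpolation_error:
  fixes f :: "real \<Rightarrow> real \<Rightarrow> real \<Rightarrow> real"
  assumes P: "xlo P < xhi P" "ylo P < yhi P"
    and smooth: "smooth_on (UNIV \<times> UNIV \<times> {0..hor P}) (\<lambda>(x, y, t). f x y t)"
  obtains C where "0 \<le> C" "\<And>M1 M2 h X Y s. 0 < M1 \<Longrightarrow> 0 < M2 \<Longrightarrow>
    Lx P / real M1 = h \<Longrightarrow> Ly P / real M2 = h \<Longrightarrow>
    X \<in> {xlo P..<xhi P} \<Longrightarrow> Y \<in> {ylo P..<yhi P} \<Longrightarrow> s \<in> {0..hor P} \<Longrightarrow>
    \<bar>interp_sp P M1 M2 (\<lambda>i j. f (node_x P M1 i) (node_y P M2 j) s) (X, Y) - f X Y s\<bar> \<le> C * h\<^sup>2"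
proof -
  define g where "g = (\<lambda>(x, y, t). f x y t)"
  let ?S = "UNIV \<times> UNIV \<times> {0..hor P} :: (real \<times> real \<times> real) set"
  let ?K = "{xlo P..xhi P} \<times> {ylo P..yhi P} \<times> {0..hor P}"
  have K: "compact ?K" "convex ?K" "?K \<subseteq> ?S"
    by (auto intro!: compact_Times convex_Times)
  have "Ck_on (Suc (Suc 0)) ?S g" using smooth unfolding smooth_on_def g_def by blast
  then obtain D where
    der: "\<And>p. p \<in> ?S \<Longrightarrow> (g has_derivative (\<lambda>v. \<Sum>b\<in>Basis. (v \<bullet> b) * D b p)) (at p within ?S)"
    and D: "\<And>b. b \<in> Basis \<Longrightarrow> Ck_on (Suc 0) ?S (D b)"
    by (auto simp only: Ck_on.simps(2)[of "Suc 0"])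
  obtain M where M0: "0 \<le> M" and M: "\<And>p q. p \<in> ?K \<Longrightarrow> q \<in> ?K \<Longrightarrow>
    \<bar>g q - g p - (\<Sum>b\<in>Basis. ((q - p) \<bullet> b) * D b p)\<bar> \<le> M * (norm (q - p))\<^sup>2"
    using first_order_taylor[OF K der D] by blast
  have "\<bar>interp_sp P M1 M2 (\<lambda>i j. f (node_x P M1 i) (node_y P M2 j) s) (X, Y) - f X Y s\<bar> \<le> 4 * M * h\<^sup>2"
    if m: "0 < M1" "0 < M2" and h: "Lx P / real M1 = h" "Ly P / real M2 = h"
      and X: "X \<in> {xlo P..<xhi P}" and Y: "Y \<in> {ylo P..<yhi P}" and s: "s \<in> {0..hor P}"
    for M1 M2 h X Y s
  proof -
    obtain i j a b where ij: "i < M1" "j < M2" and ab: "a \<in> {0..1}" "b \<in> {0..1}"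
      and XY: "X = node_x P M1 i + a * h" "Y = node_y P M2 j + b * h"
      and I: "\<And>G. interp_sp P M1 M2 G (X, Y) = (1 - a) * (1 - b) * G i j + a * (1 - b) * G (Suc i) j
          + (1 - a) * b * G i (Suc j) + a * b * G (Suc i) (Suc j)"
      using interp_sp_cell[OF P m X Y] unfolding h by metis
    have h0: "0 < h" using P m h by (auto simp: Lx_def)
    have MLx: "real M1 * h = Lx P" "real M2 * h = Ly P" using m h by (auto simp: field_simps)
    have grid: "node_x P M1 i' \<in> {xlo P..xhi P}" if "i' \<le> M1" for i'
    proof -
      have "real i' * h \<le> real M1 * h" using that h0 by (intro mult_right_mono) auto
      then show ?thesis using MLx h0 h by (simp add: node_x_def) (simp add: Lx_def)
    qed
    have grid': "node_y P M2 j' \<in> {ylo P..yhi P}" if "j' \<le> M2" for j'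
    proof -
      have "real j' * h \<le> real M2 * h" using that h0 by (intro mult_right_mono) auto
      then show ?thesis using MLx h0 h by (simp add: node_y_def) (simp add: Ly_def)
    qed
    have Suc: "node_x P M1 (Suc i) = node_x P M1 i + h" "node_y P M2 (Suc j) = node_y P M2 j + h"
      using h by (auto simp: node_x_def node_y_def algebra_simps)
    \<comment> \<open>Taylor remainder at the point displaced by \<open>(dx, dy)\<close> from the interpolation point.\<close>
    define R where "R dx dy = f (X + dx) (Y + dy) s - f X Y s
      - dx * D (1, 0, 0) (X, Y, s) - dy * D (0, 1, 0) (X, Y, s)" for dx dy
    have R: "\<bar>R dx dy\<bar> \<le> 4 * M * h\<^sup>2"
      if "\<bar>dx\<bar> \<le> h" "\<bar>dy\<bar> \<le> h" "X + dx \<in> {xlo P..xhi P}" "Y + dy \<in> {ylo P..yhi P}" for dx dy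
    proof -
      have "\<bar>R dx dy\<bar> \<le> M * (norm (dx, dy, 0::real))\<^sup>2"
        using M[of "(X, Y, s)" "(X + dx, Y + dy, s)"] that X Y s
        by (simp add: R_def g_def sum_Basis_space_time algebra_simps)
      also have "\<dots> \<le> M * (2 * h)\<^sup>2"
        using norm_space_time_le[of dx dy 0] that M0 by (intro mult_left_mono power_mono) auto
      finally show ?thesis by (simp add: power_mult_distrib)
    qed
    have ah: "0 \<le> a * h" "a * h \<le> h" "0 \<le> b * h" "b * h \<le> h"
      using ab h0 by (auto simp: mult_left_le_one_le)
    have "(1 - a) * (1 - b) * f (node_x P M1 i) (node_y P M2 j) s
        + a * (1 - b) * f (node_x P M1 (Suc i)) (node_y P M2 j) s
        + (1 - a) * b * f (node_x P M1 i) (node_y P M2 (Suc j)) s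
        + a * b * f (node_x P M1 (Suc i)) (node_y P M2 (Suc j)) s - f X Y s
      = (1 - a) * (1 - b) * R (- (a * h)) (- (b * h)) + a * (1 - b) * R (h - a * h) (- (b * h))
        + (1 - a) * b * R (- (a * h)) (h - b * h) + a * b * R (h - a * h) (h - b * h)"
      unfolding R_def Suc XY by (simp add: algebra_simps)
    also have "\<bar>\<dots>\<bar> \<le> 4 * M * h\<^sup>2"
      using ah grid[of i] grid[of "Suc i"] grid'[of j] grid'[of "Suc j"] ij
      by (intro bilinear_average_le ab R) (auto simp: Suc XY)
    finally show ?thesis unfolding I .
  qed
  with M0 show thesis by (intro that[of "4 * M"]) simp_all
qed

section \<open>Local truncation error\<close>

lemma smooth_on_partials:
  assumes "smooth_on S g"
  obtains D D2 where
    "\<And>p. p \<in> S \<Longrightarrow> (g has_derivative (\<lambda>v. \<Sum>b\<in>Basis. (v \<bullet> b) * D b p)) (at p within S)"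
    "\<And>b p. b \<in> Basis \<Longrightarrow> p \<in> S \<Longrightarrow>
      (D b has_derivative (\<lambda>v. \<Sum>c\<in>Basis. (v \<bullet> c) * D2 b c p)) (at p within S)"
    "\<And>b. b \<in> Basis \<Longrightarrow> Ck_on (Suc (Suc (Suc 0))) S (D b)"
    "\<And>b c. b \<in> Basis \<Longrightarrow> c \<in> Basis \<Longrightarrow> Ck_on (Suc (Suc 0)) S (D2 b c)"
proof -
  have "Ck_on (Suc (Suc (Suc (Suc 0)))) S g" using assms unfolding smooth_on_def by blast
  then obtain D where
    d1: "\<And>p. p \<in> S \<Longrightarrow> (g has_derivative (\<lambda>v. \<Sum>b\<in>Basis. (v \<bullet> b) * D b p)) (at p within S)"
    and D: "\<And>b. b \<in> Basis \<Longrightarrow> Ck_on (Suc (Suc (Suc 0))) S (D b)"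
    by (auto simp only: Ck_on.simps(2)[of "Suc (Suc (Suc 0))"])
  from D have "\<forall>b\<in>Basis. \<exists>E.
      (\<forall>p\<in>S. (D b has_derivative (\<lambda>v. \<Sum>c\<in>Basis. (v \<bullet> c) * E c p)) (at p within S)) \<and>
      (\<forall>c\<in>Basis. Ck_on (Suc (Suc 0)) S (E c))"
    unfolding Ck_on.simps(2)[of "Suc (Suc 0)"] by (rule ballI)
  then obtain D2 where D2: "\<forall>b\<in>Basis.
      (\<forall>p\<in>S. (D b has_derivative (\<lambda>v. \<Sum>c\<in>Basis. (v \<bullet> c) * D2 b c p)) (at p within S)) \<and>
      (\<forall>c\<in>Basis. Ck_on (Suc (Suc 0)) S (D2 b c))"
    unfolding bchoice_iff by (rule exE)
  show thesis
    by (rule that[of D D2]) (use D2 in \<open>blast intro: d1 D\<close>)+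
qed

text \<open>The slab contains the whole line in a spatial direction and the whole time interval through
  each of its points, so the derivative within the slab determines the one-dimensional derivatives that
  appear in the differential equation.\<close>

context
  fixes T :: real and g :: "real \<times> real \<times> real \<Rightarrow> real" and d :: "real \<times> real \<times> real \<Rightarrow> real"
    and x y t :: real
  assumes der: "(g has_derivative (\<lambda>v. \<Sum>b\<in>Basis. (v \<bullet> b) * d b)) (at (x, y, t) within UNIV \<times> UNIV \<times> {0..T})"
    and t: "t \<in> {0..T}"
begin

lemma deriv_x_eq: "deriv (\<lambda>u. g (u, y, t)) x = d (1, 0, 0)"
proof -
  have "((\<lambda>u. g ((0, y, t) + u *\<^sub>R (1, 0, 0))) has_real_derivative
      (\<Sum>b\<in>Basis. ((1, 0, 0) \<bullet> b) * d b)) (at x within UNIV)"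
    by (rule has_real_derivative_along_line) (use der t in auto)
  then show ?thesis by (simp add: sum_Basis_space_time DERIV_imp_deriv)
qed

lemma deriv_y_eq: "deriv (\<lambda>w. g (x, w, t)) y = d (0, 1, 0)"
proof -
  have "((\<lambda>w. g ((x, 0, t) + w *\<^sub>R (0, 1, 0))) has_real_derivative
      (\<Sum>b\<in>Basis. ((0, 1, 0) \<bullet> b) * d b)) (at y within UNIV)"
    by (rule has_real_derivative_along_line) (use der t in auto)
  then show ?thesis by (simp add: sum_Basis_space_time DERIV_imp_deriv)
qed

lemma vector_derivative_t_eq:
  assumes "0 < T"
  shows "vector_derivative (\<lambda>s. g (x, y, s)) (at t within {0..T}) = d (0, 0, 1)"
proof -
  have "((\<lambda>s. g ((x, y, 0) + s *\<^sub>R (0, 0, 1))) has_real_derivative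
      (\<Sum>b\<in>Basis. ((0, 0, 1) \<bullet> b) * d b)) (at t within {0..T})"
    by (rule has_real_derivative_along_line) (use der t in auto)
  then have "((\<lambda>s. g (x, y, s)) has_vector_derivative d (0, 0, 1)) (at t within {0..T})"
    by (simp add: sum_Basis_space_time has_real_derivative_iff_has_vector_derivative)
  then show ?thesis
    using t assms by (intro vector_derivative_within_closed_interval) auto
qed

end

text \<open>These are the variances of the two branch directions; their sum is \<open>2\<close> and their difference
  \<open>2 * \<rho>\<close>, so the four equally weighted branches have correlation \<open>\<rho>\<close>.\<close>

lemma rotation_coefficients:
  fixes \<rho> :: real
  assumes "\<rho> \<in> {-1..1}"
  defines "\<theta> \<equiv> arcsin \<rho> / 2"
  shows "(sin \<theta> + cos \<theta>)\<^sup>2 = 1 + \<rho>" "(sin \<theta> - cos \<theta>)\<^sup>2 = 1 - \<rho>"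
proof -
  have "2 * sin \<theta> * cos \<theta> = \<rho>"
    using sin_double[of \<theta>] assms by simp
  then show "(sin \<theta> + cos \<theta>)\<^sup>2 = 1 + \<rho>" "(sin \<theta> - cos \<theta>)\<^sup>2 = 1 - \<rho>"
    using sin_cos_squared_add[of \<theta>] by (auto simp: power2_sum power2_diff)
qed

lemma bounded_sigma_driftD:
  assumes "bounded_sigma_drift P"
  obtains B where "0 \<le> B" "\<And>c x y t. c \<in> {sigma1 P, sigma2 P, drift1 P, drift2 P} \<Longrightarrow>
    t \<in> {0..<hor P} \<Longrightarrow> \<bar>c x y t\<bar> \<le> B"
proof -
  let ?C = "{sigma1 P, sigma2 P, drift1 P, drift2 P}"
  let ?X = "UNIV \<times> UNIV \<times> {0..<hor P} :: (real \<times> real \<times> real) set"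
  have ex: "\<exists>M. \<forall>z\<in>?X. \<bar>(\<lambda>(x, y, t). c x y t) z\<bar> \<le> M * 1" if "c \<in> ?C" for c
  proof -
    have "bounded ((\<lambda>(x, y, t). c x y t) ` ?X)"
      using assms that unfolding bounded_sigma_drift_def by blast
    then show ?thesis by (simp add: bounded_iff)
  qed
  have fin: "finite ?C" by simp
  obtain B where "0 \<le> B" and B: "\<And>c z. c \<in> ?C \<Longrightarrow> z \<in> ?X \<Longrightarrow> \<bar>(\<lambda>(x, y, t). c x y t) z\<bar> \<le> B * 1"
    by (rule uniform_constant[of ?C ?X "\<lambda>c z. \<bar>(\<lambda>(x, y, t). c x y t) z\<bar>" "\<lambda>_. 1"])
      (blast intro: ex fin zero_le_one)+
  have "\<bar>c x y t\<bar> \<le> B" if "c \<in> ?C" "t \<in> {0..<hor P}" for c x y t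
    using B[of c "(x, y, t)"] that by simp
  with \<open>0 \<le> B\<close> show thesis by (rule that)
qed

text \<open>Expansion around the drifted point rather than the node is what makes the branch points
  symmetric, at the price of comparing the second derivatives at the two points, which are \<open>O(h)\<close>
  apart. The differential equation turns \<open>rate * f\<close> into derivatives of \<open>f\<close>, so that the constant is
  made of bounds on these and on the other coefficients.\<close>

lemma local_truncation_error:
  fixes f :: "real \<Rightarrow> real \<Rightarrow> real \<Rightarrow> real"
  assumes P: "admissible_problem P" and bd: "bounded_sigma_drift P" and sol: "solves P f"
    and smooth: "smooth_on (UNIV \<times> UNIV \<times> {0..hor P}) (\<lambda>(x, y, t). f x y t)"
  obtains C where "0 \<le> C" "\<And>h x y t. 0 < h \<Longrightarrow> 0 \<le> t \<Longrightarrow> t + h \<le> hor P \<Longrightarrow>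
    x \<in> {xlo P..xhi P} \<Longrightarrow> y \<in> {ylo P..yhi P} \<Longrightarrow>
    \<bar>(\<Sum>p\<leftarrow>branch_points P h x y t. f (fst p) (snd p) (t + h))
      - 4 * (1 + rate P x y t * h) * f x y t\<bar> \<le> C * h\<^sup>2"
proof -
  define g where "g = (\<lambda>(x, y, t). f x y t)"
  let ?S = "UNIV \<times> UNIV \<times> {0..hor P} :: (real \<times> real \<times> real) set"
  let ?X = "(1, 0, 0) :: real \<times> real \<times> real"
  let ?Y = "(0, 1, 0) :: real \<times> real \<times> real"
  let ?T = "(0, 0, 1) :: real \<times> real \<times> real"
  have basis: "?X \<in> Basis" "?Y \<in> Basis" "?T \<in> Basis" by (auto simp: Basis_prod_def zero_prod_def)
  have T: "0 < hor P" using P by (simp add: admissible_problem_def)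
  obtain D D2 where
    d1: "\<And>p. p \<in> ?S \<Longrightarrow> (g has_derivative (\<lambda>v. \<Sum>b\<in>Basis. (v \<bullet> b) * D b p)) (at p within ?S)" and
    d2: "\<And>b p. b \<in> Basis \<Longrightarrow> p \<in> ?S \<Longrightarrow>
      (D b has_derivative (\<lambda>v. \<Sum>c\<in>Basis. (v \<bullet> c) * D2 b c p)) (at p within ?S)" and
    D: "\<And>b. b \<in> Basis \<Longrightarrow> Ck_on (Suc (Suc (Suc 0))) ?S (D b)" and
    D2: "\<And>b c. b \<in> Basis \<Longrightarrow> c \<in> Basis \<Longrightarrow> Ck_on (Suc (Suc 0)) ?S (D2 b c)"
    using smooth_on_partials[OF smooth[folded g_def]] by blast
  obtain B where B0: "0 \<le> B" and B: "\<And>c x y t. c \<in> {sigma1 P, sigma2 P, drift1 P, drift2 P} \<Longrightarrow>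
      t \<in> {0..<hor P} \<Longrightarrow> \<bar>c x y t\<bar> \<le> B"
    using bounded_sigma_driftD[OF bd] by blast
  \<comment> \<open>Since \<open>h \<le> hor P\<close>, no branch point is farther than \<open>R\<close> from its node in either coordinate.\<close>
  define R where "R = B * hor P + 2 * B * sqrt (hor P)"
  let ?K = "{xlo P - R..xhi P + R} \<times> {ylo P - R..yhi P + R} \<times> {0..hor P}"
  have R0: "0 \<le> R" using B0 T by (simp add: R_def)
  have K: "compact ?K" "convex ?K" "?K \<subseteq> ?S"
    by (auto intro!: compact_Times convex_Times)
  obtain M1 where M10: "0 \<le> M1" and M1: "\<And>p q. p \<in> ?K \<Longrightarrow> q \<in> ?K \<Longrightarrow>
    \<bar>g q - g p - (\<Sum>b\<in>Basis. ((q - p) \<bullet> b) * D b p)\<bar> \<le> M1 * (norm (q - p))\<^sup>2"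
    using first_order_taylor[OF K d1 D] by blast
  obtain M4 where M40: "0 \<le> M4" and M4: "\<And>p v. p \<in> ?K \<Longrightarrow> p + v \<in> ?K \<Longrightarrow> p - v \<in> ?K \<Longrightarrow>
    \<bar>g (p + v) + g (p - v) - 2 * g p
      - (\<Sum>b\<in>Basis. \<Sum>c\<in>Basis. (v \<bullet> b) * (v \<bullet> c) * D2 b c p)\<bar> \<le> M4 * norm v ^ 4"
    using symmetric_second_order_taylor[OF K d1 d2 D2] by blast
  have ex: "\<exists>M. \<forall>z\<in>?K\<times>?K. \<bar>D2 (fst e) (snd e) (fst z) - D2 (fst e) (snd e) (snd z)\<bar>
      \<le> M * norm (fst z - snd z)" if "e \<in> Basis \<times> Basis" for e
    using C1_lipschitz[OF K D2, of "fst e" "snd e"] that by (simp only: mem_Times_iff)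
  obtain L where L0: "0 \<le> L" and Le: "\<And>e z. e \<in> Basis \<times> Basis \<Longrightarrow> z \<in> ?K \<times> ?K \<Longrightarrow>
      \<bar>D2 (fst e) (snd e) (fst z) - D2 (fst e) (snd e) (snd z)\<bar> \<le> L * norm (fst z - snd z)"
    by (rule uniform_constant[of "Basis \<times> Basis" "?K \<times> ?K"
          "\<lambda>e z. \<bar>D2 (fst e) (snd e) (fst z) - D2 (fst e) (snd e) (snd z)\<bar>" "\<lambda>z. norm (fst z - snd z)"])
      (blast intro: ex finite_cartesian_product finite_Basis norm_ge_zero)+
  have L: "\<bar>D2 b c q - D2 b c p\<bar> \<le> L * norm (q - p)"
    if "p \<in> ?K" "q \<in> ?K" "b \<in> Basis" "c \<in> Basis" for p q b c
    using Le[of "(b, c)" "(q, p)"] that by (simp only: mem_Times_iff fst_conv snd_conv)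
  \<comment> \<open>The summands are the remainders of the two branch pairs, the remainder of the step from the
      node to the drifted point, and the change of the second derivatives along that step.\<close>
  define C where "C = 2 * M4 * (4 * B) ^ 4 + 4 * M1 * (2 * B + 1)\<^sup>2 + 8 * B\<^sup>2 * L * (2 * B + 1)"
  have "\<bar>(\<Sum>p\<leftarrow>branch_points P h x y t. f (fst p) (snd p) (t + h))
      - 4 * (1 + rate P x y t * h) * f x y t\<bar> \<le> C * h\<^sup>2"
    if h: "0 < h" and t: "0 \<le> t" "t + h \<le> hor P"
      and x: "x \<in> {xlo P..xhi P}" and y: "y \<in> {ylo P..yhi P}" for h x y t
  proof -
    define s1 s2 b1 b2 r \<rho> where "s1 = sigma1 P x y t" and "s2 = sigma2 P x y t"
      and "b1 = drift1 P x y t" and "b2 = drift2 P x y t" and "r = rate P x y t" and "\<rho> = rho P x y t"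
    note coeffs = this
    define \<alpha> \<beta> where "\<alpha> = sin (arcsin \<rho> / 2) + cos (arcsin \<rho> / 2)"
      and "\<beta> = sin (arcsin \<rho> / 2) - cos (arcsin \<rho> / 2)"
    define p q where "p = (x, y, t)" and "q = (x + b1 * h, y + b2 * h, t + h)"
    define v1 v2 where "v1 = (\<alpha> * s1 * sqrt h, \<alpha> * s2 * sqrt h, 0::real)"
      and "v2 = (- \<beta> * s1 * sqrt h, \<beta> * s2 * sqrt h, 0::real)"
    have t': "t \<in> {0..<hor P}" "t \<in> {0..hor P}" using t h by auto
    have bounds: "\<bar>s1\<bar> \<le> B" "\<bar>s2\<bar> \<le> B" "\<bar>b1\<bar> \<le> B" "\<bar>b2\<bar> \<le> B"
      using B t' by (auto simp: coeffs)
    have \<rho>: "\<rho> \<in> {-1..1}" using P t' by (simp add: admissible_problem_def coeffs)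
    have \<alpha>\<beta>: "\<alpha>\<^sup>2 = 1 + \<rho>" "\<beta>\<^sup>2 = 1 - \<rho>"
      unfolding \<alpha>_def \<beta>_def using rotation_coefficients[OF \<rho>] by auto
    have \<alpha>\<beta>_le: "\<bar>\<alpha>\<bar> \<le> 2" "\<bar>\<beta>\<bar> \<le> 2"
      unfolding \<alpha>_def \<beta>_def
      using sin_le_one cos_le_one sin_ge_minus_one cos_ge_minus_one by (smt (verit))+
    have vle: "\<bar>c * s * sqrt h\<bar> \<le> 2 * B * sqrt h" if "\<bar>c\<bar> \<le> 2" "\<bar>s\<bar> \<le> B" for c s
      using that h by (auto simp: abs_mult intro!: mult_mono)
    have ble: "\<bar>b * h\<bar> \<le> B * h" if "\<bar>b\<bar> \<le> B" for b
      using that h by (simp add: abs_mult)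
    have "B * h \<le> B * hor P" "2 * B * sqrt h \<le> 2 * B * sqrt (hor P)"
      using t B0 by (auto intro!: mult_left_mono)
    then have "\<bar>b * h\<bar> + \<bar>c * s * sqrt h\<bar> \<le> R" if "\<bar>b\<bar> \<le> B" "\<bar>c\<bar> \<le> 2" "\<bar>s\<bar> \<le> B" for b c s
      using vle[OF that(2,3)] ble[OF that(1)] unfolding R_def by linarith
    note reach = this[OF bounds(3) \<alpha>\<beta>_le(1) bounds(1)] this[OF bounds(3) \<alpha>\<beta>_le(2) bounds(1)]
      this[OF bounds(4) \<alpha>\<beta>_le(1) bounds(2)] this[OF bounds(4) \<alpha>\<beta>_le(2) bounds(2)]
    have shift: "u \<in> {lo - R..hi + R}" "u + d \<in> {lo - R..hi + R}"
      "u + d + e \<in> {lo - R..hi + R}" "u + d - e \<in> {lo - R..hi + R}"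
      if "u \<in> {lo..hi}" "\<bar>d\<bar> + \<bar>e\<bar> \<le> R" for u d e lo hi
      using that unfolding atLeastAtMost_iff by linarith+
    have inK: "p \<in> ?K" "q \<in> ?K" "q + v1 \<in> ?K" "q - v1 \<in> ?K" "q + v2 \<in> ?K" "q - v2 \<in> ?K"
      using shift[OF x reach(1)] shift[OF x reach(2)] shift[OF y reach(3)] shift[OF y reach(4)] t h
      by (simp_all add: p_def q_def v1_def v2_def)
    let ?Q = "\<lambda>v z. \<Sum>b\<in>Basis. \<Sum>c\<in>Basis. (v \<bullet> b) * (v \<bullet> c) * D2 b c z"
    have inS: "p \<in> ?S" "q \<in> ?S" using inK K(3) by auto
    have comm: "D2 ?Y ?X z = D2 ?X ?Y z" if "z \<in> {p, q}" for z
    proof -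
      obtain u w \<tau> where z: "z = (u, w, \<tau>)" by (cases z) auto
      let ?K' = "{u..u + 1} \<times> {w..w + 1} \<times> {0..hor P}"
      have \<tau>: "\<tau> \<in> {0..hor P}" using that inS z by auto
      have K': "compact ?K'" "convex ?K'" "?K' \<subseteq> ?S"
        by (auto intro!: compact_Times convex_Times)
      show ?thesis
        by (rule mixed_partials_commute[OF K' d1 d2 D2 basis(2,1)]) (use z \<tau> in auto)
    qed
    have Q: "?Q v1 z + ?Q v2 z = h * (2 * s1\<^sup>2 * D2 ?X ?X z + 4 * \<rho> * s1 * s2 * D2 ?X ?Y z
        + 2 * s2\<^sup>2 * D2 ?Y ?Y z)" if "z \<in> {p, q}" for z
    proof -
      have "?Q (\<alpha> * s1 * w, \<alpha> * s2 * w, 0) z + ?Q (- \<beta> * s1 * w, \<beta> * s2 * w, 0) z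
        = (w * w) * ((\<alpha>\<^sup>2 + \<beta>\<^sup>2) * s1\<^sup>2 * D2 ?X ?X z
          + 2 * (\<alpha>\<^sup>2 - \<beta>\<^sup>2) * s1 * s2 * D2 ?X ?Y z + (\<alpha>\<^sup>2 + \<beta>\<^sup>2) * s2\<^sup>2 * D2 ?Y ?Y z)" for w
        unfolding sum_Basis_space_time
        by (simp add: comm[OF that] power2_eq_square) (simp only: algebra_simps)
      note this[of "sqrt h", folded v1_def v2_def]
      moreover have "sqrt h * sqrt h = h" using h by simp
      ultimately show ?thesis unfolding \<alpha>\<beta> by (simp add: algebra_simps)
    qed
    have nq: "norm (q - p) \<le> (2 * B + 1) * h"
    proof -
      have "norm (q - p) \<le> \<bar>b1 * h\<bar> + \<bar>b2 * h\<bar> + \<bar>h\<bar>"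
        using norm_space_time_le[of "b1 * h" "b2 * h" h] by (simp add: p_def q_def)
      then show ?thesis using ble[OF bounds(3)] ble[OF bounds(4)] h by (simp add: algebra_simps)
    qed
    have nv: "M4 * norm v ^ 4 \<le> M4 * (4 * B) ^ 4 * h\<^sup>2" if "v \<in> {v1, v2}" for v
    proof -
      have "norm v \<le> 4 * B * sqrt h"
        using that norm_space_time_le[of "\<alpha> * s1 * sqrt h" "\<alpha> * s2 * sqrt h" 0]
          norm_space_time_le[of "- \<beta> * s1 * sqrt h" "\<beta> * s2 * sqrt h" 0]
          vle[OF \<alpha>\<beta>_le(1) bounds(1)] vle[OF \<alpha>\<beta>_le(1) bounds(2)]
          vle[OF \<alpha>\<beta>_le(2) bounds(1)] vle[OF \<alpha>\<beta>_le(2) bounds(2)]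
        by (auto simp: v1_def v2_def)
      then have "norm v ^ 4 \<le> (4 * B * sqrt h) ^ 4" by (intro power_mono) auto
      also have "\<dots> = (4 * B) ^ 4 * ((sqrt h)\<^sup>2)\<^sup>2"
        by (simp add: power_mult_distrib flip: power_mult)
      also have "\<dots> = (4 * B) ^ 4 * h\<^sup>2" using h by simp
      finally show ?thesis using M40 by (simp add: mult_left_mono mult.assoc)
    qed
    have branches: "\<bar>g (q + v) + g (q - v) - 2 * g q - ?Q v q\<bar> \<le> M4 * (4 * B) ^ 4 * h\<^sup>2"
      if "v \<in> {v1, v2}" for v
    proof -
      have "q + v \<in> ?K" "q - v \<in> ?K" using that inK by auto
      then show ?thesis using M4[OF inK(2)] nv[OF that] by (meson order_trans)
    qed
    have centre: "\<bar>g q - g p - h * (b1 * D ?X p + b2 * D ?Y p + D ?T p)\<bar> \<le> M1 * (2 * B + 1)\<^sup>2 * h\<^sup>2"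
    proof -
      have "\<bar>g q - g p - h * (b1 * D ?X p + b2 * D ?Y p + D ?T p)\<bar> \<le> M1 * (norm (q - p))\<^sup>2"
        using M1[OF inK(1,2)] by (simp add: sum_Basis_space_time p_def q_def algebra_simps)
      also have "\<dots> \<le> M1 * ((2 * B + 1) * h)\<^sup>2"
        using nq M10 by (intro mult_left_mono power_mono) auto
      finally show ?thesis by (simp add: power_mult_distrib mult.assoc)
    qed
    have drift: "\<bar>(?Q v1 q + ?Q v2 q) - (?Q v1 p + ?Q v2 p)\<bar> \<le> 8 * B\<^sup>2 * L * (2 * B + 1) * h\<^sup>2"
    proof -
      let ?l = "L * ((2 * B + 1) * h)"
      have d: "\<bar>D2 b c q - D2 b c p\<bar> \<le> ?l" if "b \<in> Basis" "c \<in> Basis" for b c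
        using L[OF inK(1,2) that] nq L0 by (meson mult_left_mono order_trans)
      have sq: "s1\<^sup>2 \<le> B\<^sup>2" "s2\<^sup>2 \<le> B\<^sup>2" using power_mono[OF bounds(1), of 2] power_mono[OF bounds(2), of 2] by simp_all
      have 1: "\<bar>2 * s1\<^sup>2 * (D2 ?X ?X q - D2 ?X ?X p)\<bar> \<le> (2 * B\<^sup>2) * ?l"
        unfolding abs_mult using d basis sq by (intro mult_mono) auto
      have 2: "\<bar>2 * s2\<^sup>2 * (D2 ?Y ?Y q - D2 ?Y ?Y p)\<bar> \<le> (2 * B\<^sup>2) * ?l"
        unfolding abs_mult using d basis sq by (intro mult_mono) auto
      have "\<bar>\<rho>\<bar> * \<bar>s1\<bar> * \<bar>s2\<bar> \<le> 1 * B * B"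
        using \<rho> bounds B0 by (intro mult_mono) auto
      then have "\<bar>4 * \<rho> * s1 * s2\<bar> \<le> 4 * B\<^sup>2" by (simp add: abs_mult power2_eq_square mult.assoc)
      then have 3: "\<bar>4 * \<rho> * s1 * s2 * (D2 ?X ?Y q - D2 ?X ?Y p)\<bar> \<le> (4 * B\<^sup>2) * ?l"
        unfolding abs_mult[of "4 * \<rho> * s1 * s2"] using d basis by (intro mult_mono) auto
      have "(?Q v1 q + ?Q v2 q) - (?Q v1 p + ?Q v2 p) = h * (2 * s1\<^sup>2 * (D2 ?X ?X q - D2 ?X ?X p)
          + 4 * \<rho> * s1 * s2 * (D2 ?X ?Y q - D2 ?X ?Y p) + 2 * s2\<^sup>2 * (D2 ?Y ?Y q - D2 ?Y ?Y p))"
        using Q[of p] Q[of q] by (simp add: algebra_simps)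
      also have "\<bar>\<dots>\<bar> \<le> h * (8 * B\<^sup>2 * ?l)"
        unfolding abs_mult using 1 2 3 h by (intro mult_mono) auto
      finally show ?thesis by (simp add: power2_eq_square mult_ac)
    qed
    \<comment> \<open>\<open>solves\<close> differentiates in \<open>y\<close> first, so its mixed derivative is \<open>D2 ?Y ?X p\<close>, not \<open>D2 ?X ?Y p\<close>.\<close>
    have pde: "D ?T p + 1/2 * s1\<^sup>2 * D2 ?X ?X p + \<rho> * s1 * s2 * D2 ?X ?Y p
        + 1/2 * s2\<^sup>2 * D2 ?Y ?Y p + b1 * D ?X p + b2 * D ?Y p - r * g p = 0"
    proof -
      have 1: "deriv (\<lambda>u. f u w t) = (\<lambda>z. D ?X (z, w, t))" "deriv (\<lambda>w. f z w t) = (\<lambda>w. D ?Y (z, w, t))" for z w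
        using deriv_x_eq[OF d1 t'(2)] deriv_y_eq[OF d1 t'(2)] t' by (auto simp: g_def)
      have 2: "deriv (\<lambda>u. D ?X (u, y, t)) x = D2 ?X ?X p" "deriv (\<lambda>u. D ?Y (u, y, t)) x = D2 ?Y ?X p"
        "deriv (\<lambda>w. D ?Y (x, w, t)) y = D2 ?Y ?Y p"
        using deriv_x_eq[OF d2[OF basis(1)] t'(2), of x y] deriv_x_eq[OF d2[OF basis(2)] t'(2), of x y]
          deriv_y_eq[OF d2[OF basis(2)] t'(2), of x y] t' by (auto simp: p_def)
      have 3: "vector_derivative (\<lambda>s. f x y s) (at t within {0..hor P}) = D ?T p"
        using vector_derivative_t_eq[OF d1 t'(2) T, of x y] t' by (auto simp: p_def g_def)
      show ?thesis
        using sol[unfolded solves_def, THEN conjunct1, rule_format, OF t'(1), of x y] comm[of p]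
        by (simp add: 1 2 3 coeffs) (simp add: p_def g_def)
    qed
    have "(\<Sum>p\<leftarrow>branch_points P h x y t. f (fst p) (snd p) (t + h))
        = (g (q + v1) + g (q - v1)) + (g (q + v2) + g (q - v2))"
      unfolding branch_points_def Let_def coeffs[symmetric] \<alpha>_def[symmetric] \<beta>_def[symmetric]
      by (simp add: g_def q_def v1_def v2_def mult.assoc)
    moreover have "4 * (1 + rate P x y t * h) * f x y t = 4 * g p + 4 * h * (r * g p)"
      by (simp add: g_def p_def coeffs algebra_simps)
    moreover have growth: "4 * h * (r * g p) = 4 * (h * (b1 * D ?X p + b2 * D ?Y p + D ?T p)) + (?Q v1 p + ?Q v2 p)"
    proof -
      have "r * g p = D ?T p + 1/2 * s1\<^sup>2 * D2 ?X ?X p + \<rho> * s1 * s2 * D2 ?X ?Y p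
        + 1/2 * s2\<^sup>2 * D2 ?Y ?Y p + b1 * D ?X p + b2 * D ?Y p" using pde by linarith
      then show ?thesis by (simp only: Q[of p] insertI1) (simp add: algebra_simps)
    qed
    moreover have "C * h\<^sup>2 = 2 * (M4 * (4 * B) ^ 4 * h\<^sup>2) + 4 * (M1 * (2 * B + 1)\<^sup>2 * h\<^sup>2)
        + 8 * B\<^sup>2 * L * (2 * B + 1) * h\<^sup>2"
      unfolding C_def by (simp only: ring_distribs mult.assoc)
    \<comment> \<open>Stated for arbitrary reals, since the sums in the actual terms hamper linear arithmetic.\<close>
    moreover have "\<bar>(S1 + S2) - (4 * gp + G)\<bar> \<le> 2 * m + 4 * c + l"
      if "\<bar>S1 - 2 * gq - Q1\<bar> \<le> m" "\<bar>S2 - 2 * gq - Q2\<bar> \<le> m" "\<bar>gq - gp - d\<bar> \<le> c"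
        "\<bar>(Q1 + Q2) - (q1 + q2)\<bar> \<le> l" "G = 4 * d + (q1 + q2)"
      for S1 S2 gp gq G Q1 Q2 q1 q2 d m c l :: real
      using that by linarith
    note this[OF branches[OF insertI1] branches[OF insertI2[OF singletonI]] centre drift growth]
    ultimately show ?thesis by metis
  qed
  moreover have "0 \<le> C"
    unfolding C_def using M10 M40 B0 L0 by simp
  ultimately show thesis by (intro that)
qed

section \<open>Convergence of the scheme\<close>

theorem theorem4:
  fixes P :: periodic_problem
    and f :: "real \<Rightarrow> real \<Rightarrow> real \<Rightarrow> real"
  assumes "admissible_problem P"
    and "bounded_sigma_drift P"
    and "solves P f"
    and "smooth_on (UNIV \<times> UNIV \<times> {0..hor P}) (\<lambda>(x, y, t). f x y t)"
  shows "\<exists>C>0. \<forall>M1 M2 N :: nat. \<forall>F :: nat \<Rightarrow> nat \<Rightarrow> nat \<Rightarrow> real.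
           0 < M1 \<and> 0 < M2 \<and> 0 < N \<and>
           hor P / real N = Lx P / real M1 \<and> Lx P / real M1 = Ly P / real M2 \<and>
           scheme_solution P M1 M2 N F \<longrightarrow>
           (\<forall>n\<le>N. error_norm P f M1 M2 N F n \<le> C * (hor P / real N))"
proof -
  have P: "xlo P < xhi P" "ylo P < yhi P" "0 < hor P"
    and rate: "\<And>x y t. t \<in> {0..<hor P} \<Longrightarrow> 0 \<le> rate P x y t"
    using assms(1) by (auto simp: admissible_problem_def)
  have at_hor: "\<And>x y. f x y (hor P) = terminal P x y"
    and per: "\<And>t. t \<in> {0..hor P} \<Longrightarrow> doubly_periodic P (\<lambda>x y. f x y t)"
    using assms(3) by (auto simp: solves_def)
  obtain Ct where Ct0: "0 \<le> Ct" and Ct: "\<And>h x y t. 0 < h \<Longrightarrow> 0 \<le> t \<Longrightarrow> t + h \<le> hor P \<Longrightarrow>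
    x \<in> {xlo P..xhi P} \<Longrightarrow> y \<in> {ylo P..yhi P} \<Longrightarrow>
    \<bar>(\<Sum>p\<leftarrow>branch_points P h x y t. f (fst p) (snd p) (t + h))
      - 4 * (1 + rate P x y t * h) * f x y t\<bar> \<le> Ct * h\<^sup>2"
    using local_truncation_error[OF assms] by blast
  obtain Ci where Ci0: "0 \<le> Ci" and Ci: "\<And>M1 M2 h X Y s. 0 < M1 \<Longrightarrow> 0 < M2 \<Longrightarrow>
    Lx P / real M1 = h \<Longrightarrow> Ly P / real M2 = h \<Longrightarrow>
    X \<in> {xlo P..<xhi P} \<Longrightarrow> Y \<in> {ylo P..<yhi P} \<Longrightarrow> s \<in> {0..hor P} \<Longrightarrow>
    \<bar>interp_sp P M1 M2 (\<lambda>i j. f (node_x P M1 i) (node_y P M2 j) s) (X, Y) - f X Y s\<bar> \<le> Ci * h\<^sup>2"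
    using interpolation_error[OF P(1,2) assms(4)] by blast
  let ?C = "Ct + Ci + 1"
  have "error_norm P f M1 M2 N F n \<le> (hor P * ?C) * (hor P / real N)"
    if M: "0 < M1" "0 < M2" "0 < N" and mesh: "hor P / real N = Lx P / real M1" "Lx P / real M1 = Ly P / real M2"
      and F: "scheme_solution P M1 M2 N F" and n: "n \<le> N" for M1 M2 N F n
  proof -
    define h where "h = hor P / real N"
    have h: "0 < h" "Lx P / real M1 = h" "Ly P / real M2 = h"
      using P(3) M(3) unfolding h_def mesh by (simp_all flip: mesh)
    have Nh: "real N * h = hor P" using M by (simp add: h_def)
    define e where "e n i j = F n i j - f (node_x P M1 i) (node_y P M2 j) (node_t P N n)" for n i j
    have node_t: "node_t P N n = real n * h" for n by (simp add: node_t_def h_def)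
    have step: "\<bar>e n i j\<bar> \<le> E + ?C * h\<^sup>2"
      if n: "n < N" and ij: "i \<le> M1" "j \<le> M2"
        and E: "\<And>i j. i \<le> M1 \<Longrightarrow> j \<le> M2 \<Longrightarrow> \<bar>e (Suc n) i j\<bar> \<le> E" for n i j E
    proof -
      define x y t where "x = node_x P M1 i" and "y = node_y P M2 j" and "t = node_t P N n"
      let ?I = "\<lambda>G p. interp_sp P M1 M2 G (wrap P p)"
      let ?f = "\<lambda>p. f (fst p) (snd p) (t + h)"
      have t_Suc: "node_t P N (Suc n) = t + h" by (simp add: t_def node_t algebra_simps)
      have "real (Suc n) * h \<le> real N * h" using n h by (intro mult_right_mono) auto
      then have t: "0 \<le> t" "t + h \<le> hor P" using h t_Suc Nh by (auto simp: t_def node_t)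
      have "real i * h \<le> real M1 * h" "real j * h \<le> real M2 * h"
        using ij h by (auto intro!: mult_right_mono)
      moreover have "real M1 * h = Lx P" "real M2 * h = Ly P" using M h by (auto simp: field_simps)
      ultimately have xy: "x \<in> {xlo P..xhi P}" "y \<in> {ylo P..yhi P}"
        using h by (auto simp: x_def y_def node_x_def node_y_def Lx_def Ly_def)
      let ?r = "rate P x y t"
      have r: "0 \<le> ?r * h" using rate[of t] t h by simp
      have branch: "\<bar>?I (F (Suc n)) p - ?f p\<bar> \<le> E + Ci * h\<^sup>2" for p
      proof -
        obtain X Y where w: "wrap P p = (X, Y)" by fastforce
        have XY: "X \<in> {xlo P..<xhi P}" "Y \<in> {ylo P..<yhi P}"
          using wrap_in_rectangle[OF P(1,2), of p] w by auto
        let ?G = "\<lambda>i j. f (node_x P M1 i) (node_y P M2 j) (t + h)"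
        have "\<bar>interp_sp P M1 M2 (F (Suc n)) (X, Y) - interp_sp P M1 M2 ?G (X, Y)\<bar> \<le> E"
          using E by (intro interp_sp_diff_le P M XY) (auto simp: e_def t_Suc)
        moreover have "\<bar>interp_sp P M1 M2 ?G (X, Y) - f X Y (t + h)\<bar> \<le> Ci * h\<^sup>2"
          using t h by (intro Ci M h XY) auto
        moreover have "f X Y (t + h) = ?f p"
          using doubly_periodic_wrap[OF P(1,2) per, of "t + h" p] t h w by simp
        ultimately show ?thesis using w by simp
      qed
      obtain p1 p2 p3 p4 where bp: "branch_points P h x y t = [p1, p2, p3, p4]"
        by (simp add: branch_points_def Let_def)
      have "F n i j = 1 / (4 * (1 + ?r * h)) * (\<Sum>p\<leftarrow>branch_points P h x y t. ?I (F (Suc n)) p)"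
        using F n ij unfolding scheme_solution_def x_def y_def t_def h_def by (simp add: Let_def)
      then have "4 * (1 + ?r * h) * F n i j = (\<Sum>p\<leftarrow>branch_points P h x y t. ?I (F (Suc n)) p)"
        using r by (simp add: field_simps)
      then have "\<bar>4 * (1 + ?r * h) * F n i j - 4 * (1 + ?r * h) * f x y t\<bar> \<le> 4 * (E + Ci * h\<^sup>2) + Ct * h\<^sup>2"
        using Ct[OF h(1) t xy] branch[of p1] branch[of p2] branch[of p3] branch[of p4]
        by (simp add: bp)
      moreover have "4 * (1 + ?r * h) * F n i j - 4 * (1 + ?r * h) * f x y t = 4 * ((1 + ?r * h) * e n i j)"
        by (simp add: e_def x_def y_def t_def algebra_simps)
      \<comment> \<open>The discount factor only helps, however large the rate is.\<close>
      moreover have "\<bar>e n i j\<bar> \<le> \<bar>(1 + ?r * h) * e n i j\<bar>"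
        using r by (simp add: abs_mult mult_le_cancel_right1)
      ultimately have "4 * \<bar>e n i j\<bar> \<le> 4 * (E + Ci * h\<^sup>2) + Ct * h\<^sup>2"
        by (simp add: abs_mult)
      moreover have "0 \<le> Ct * h\<^sup>2" "0 \<le> h\<^sup>2" using Ct0 by auto
      moreover have "E + ?C * h\<^sup>2 = E + Ct * h\<^sup>2 + Ci * h\<^sup>2 + h\<^sup>2" by (simp add: ring_distribs)
      ultimately show ?thesis unfolding distrib_left by linarith
    qed
    have err: "\<bar>e (N - m) i j\<bar> \<le> real m * (?C * h\<^sup>2)" if "m \<le> N" "i \<le> M1" "j \<le> M2" for m i j
      using that
    proof (induction m arbitrary: i j)
      case 0
      then have "e N i j = 0" using F at_hor Nh by (simp add: scheme_solution_def e_def node_t)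
      then show ?case by simp
    next
      case (Suc m)
      then have "Suc (N - Suc m) = N - m" by simp
      then have "\<bar>e (N - Suc m) i j\<bar> \<le> real m * (?C * h\<^sup>2) + ?C * h\<^sup>2"
        using Suc by (intro step) auto
      then show ?case by (simp add: algebra_simps)
    qed
    have "\<bar>e n i j\<bar> \<le> hor P * ?C * h" if "i \<le> M1" "j \<le> M2" for i j
    proof -
      have "\<bar>e n i j\<bar> \<le> real (N - n) * (?C * h\<^sup>2)" using err[of "N - n" i j] n that by simp
      also have "\<dots> \<le> real N * (?C * h\<^sup>2)"
        using Ct0 Ci0 by (intro mult_right_mono mult_nonneg_nonneg) auto
      also have "\<dots> = (real N * h) * ?C * h" by (simp add: power2_eq_square)
      finally show ?thesis using Nh by simp
    qed
    then show ?thesis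
      unfolding error_norm_def h_def[symmetric] by (subst Max_le_iff) (auto simp: e_def)
  qed
  moreover have "0 < hor P * ?C" using P Ct0 Ci0 by simp
  ultimately show ?thesis by (intro exI[of _ "hor P * ?C"]) blast
qed

end
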